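(* Let $S$ be a set of sorts and $\Sigma$ an $S$-sorted signature such that, for every $S$-sorted set $A$, the support $\{s\in S\mid \mathrm{T}_\Sigma(A)_s\neq\varnothing\}$ of the free $\Sigma$-algebra $\mathbf{T}_\Sigma(A)$ is finite (equivalently, $S$ is finite). Then the complete lattices $\mathbf{Form}_{\mathrm{Cgr}_{\mathrm{fi}}}(\Sigma)$ (all formations of finite index congruences with respect to $\Sigma$) and $\mathbf{Form}_{\mathrm{Lang_r}}(\Sigma)$ (all formations of regular languages with respect to $\Sigma$), both ordered pointwise by inclusion, are isomorphic.
   Context: Fix a Grothendieck universe $\mathcal{U}$, a set of sorts $S\in\mathcal{U}$ and an $S$-sorted signature $\Sigma$, i.e. a family of sets $\Sigma_{w,s}\in\mathcal{U}$ indexed by $w\in S^{\star}$ (finite words on $S$) and $s\in S$. An $S$-sorted set is a family $A=(A_s)_{s\in S}$ of sets in $\mathcal{U}$ (components may be empty); it is finite if $\coprod_{s\in S}A_s$ is finite; $\mathcal{U}^S$ is the set of all $S$-sorted sets. Subsets, intersections, etc. are componentwise. A $\Sigma$-algebra $\mathbf{A}$ is an $S$-sorted set $A$ with an operation $F_\sigma\colon A_w=\prod_{i<|w|}A_{w_i}\to A_s$ for each $\sigma\in\Sigma_{w,s}$. Homomorphisms are $S$-sorted mappings commuting with all operations; epimorphism means homomorphism surjective in each sort. A congruence on $\mathbf{A}$ is a family $\Phi=(\Phi_s)_{s\in S}$ of equivalence relations on the $A_s$ compatible with all operations; it is of finite index if $A/\Phi$ is finite; $\mathbf{Cgr}(\mathbf{A})$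 is the lattice of congruences under inclusion; $\mathrm{pr}^\Phi\colon\mathbf{A}\to\mathbf{A}/\Phi$ is the projection; $\nabla^{\mathbf{A}}$ is the greatest congruence; $\mathrm{Ker}(f)$ is the kernel congruence of $f$. $\mathbf{T}_\Sigma(A)$ is the free $\Sigma$-algebra on $A$, with underlying $S$-sorted set $\mathrm{T}_\Sigma(A)$. For a congruence $\Phi$ on $\mathbf{A}$, $L\subseteq A$ is $\Phi$-saturated if each $L_s$ is a union of $\Phi_s$-classes; $\Phi\text{-}\mathrm{Sat}(A)$ is the set of $\Phi$-saturated subsets. $\Omega^{\mathbf{A}}(L)$ is the greatest congruence on $\mathbf{A}$ for which $L$ is saturated. $L\subseteq A$ is regular if $\Omega^{\mathbf{A}}(L)$ is of finite index; $\mathrm{Lang_r}(\mathbf{A})$ is the set of regular $L\subseteq A$. A formation of finite index congruences with respect to $\Sigma$ is a function $\mathfrak{F}$ on $\mathcal{U}^S$ such that: (1) for every $A\in\mathcal{U}^S$, $\mathfrak{F}(A)$ is a filter of $\mathbf{Cgr}(\mathbf{T}_\Sigma(A))$ (nonempty, closed under binary intersection, upward closed) all of whose members are of finite index; (2) for all $A,B\in\mathcal{U}^S$, $\Theta\in\mathfrak{F}(B)$ and homomorphisms $f\colon\mathbf{T}_\Sigma(A)\to\mathbf{T}_\Sigma(B)$, if $\mathrm{pr}^{\Theta}\circ f$ is an epimorphism, then $\mathrm{Ker}(\mathrm{pr}^{\Theta}\circ f)\in\mathfrak{F}(A)$. Order: $\mathfrak{F}\le\mathfrak{G}$ iff $\mathfrak{F}(A)\subseteq\mathfrak{G}(A)$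 for all $A$. A formation of regular languages with respect to $\Sigma$ is a function $\mathcal{L}$ on $\mathcal{U}^S$ with $\mathcal{L}(A)\subseteq\mathrm{Lang_r}(\mathbf{T}_\Sigma(A))$ for all $A$ such that: (1) for every $A$, $\nabla^{\mathbf{T}_\Sigma(A)}\text{-}\mathrm{Sat}(\mathrm{T}_\Sigma(A))\subseteq\mathcal{L}(A)$; (2) for every $A$ and $L,L'\in\mathcal{L}(A)$, $(\Omega^{\mathbf{T}_\Sigma(A)}(L)\cap\Omega^{\mathbf{T}_\Sigma(A)}(L'))\text{-}\mathrm{Sat}(\mathrm{T}_\Sigma(A))\subseteq\mathcal{L}(A)$; (3) for all $A,B$, $M\in\mathcal{L}(B)$ and homomorphisms $f\colon\mathbf{T}_\Sigma(A)\to\mathbf{T}_\Sigma(B)$, if $\mathrm{pr}^{\Omega^{\mathbf{T}_\Sigma(B)}(M)}\circ f$ is an epimorphism, then $\mathrm{Ker}(\mathrm{pr}^{\Omega^{\mathbf{T}_\Sigma(B)}(M)}\circ f)\text{-}\mathrm{Sat}(\mathrm{T}_\Sigma(A))\subseteq\mathcal{L}(A)$. Order: $\mathcal{L}\le\mathcal{M}$ iff $\mathcal{L}(A)\subseteq\mathcal{M}(A)$ for all $A$. *)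

theory Defs
  imports "HOL-Algebra.Complete_Lattice"
begin

text \<open>
  A Grothendieck universe is represented by the type \<open>'u\<close> of its members together with the
  function \<open>el\<close> that sends a member to the set of its elements. A set \<open>X :: 'u set\<close> belongs to the
  universe iff \<open>X \<in> range el\<close>; transitivity is built into the type of \<open>el\<close>, and injectivity is
  extensionality. The closure conditions are: unordered pairs, power sets (the power set of a
  member is a member, hence so is each of its subsets) and unions of families indexed by a member.
  That the set of natural numbers is a member is not demanded.
\<close>

definition grothendieck_universe :: "('u \<Rightarrow> 'u set) \<Rightarrow> bool" where
  "grothendieck_universe el \<longleftrightarrow>
     inj el \<and>
     (\<forall>x y. {x, y} \<in> range el) \<and>
     (\<forall>x. \<exists>p. el ` el p = Pow (el x)) \<and>
     (\<forall>x f. (\<Union>i\<in>el x. el (f i)) \<in> range el)"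


text \<open>
  Families indexed by a set of sorts \<open>S\<close> (sorted sets, congruences, sorted subsets) are total
  functions that are empty off \<open>S\<close>, so that equality, \<open>\<le>\<close> and pointwise \<open>\<inter>\<close> of functions are
  the componentwise notions. \<open>U\<close> is the collection of admissible components.
\<close>

definition sorted_sets :: "'x set set \<Rightarrow> 's set \<Rightarrow> ('s \<Rightarrow> 'x set) set" where
  "sorted_sets U S = {A. (\<forall>s\<in>S. A s \<in> U) \<and> (\<forall>s. s \<notin> S \<longrightarrow> A s = {})}"

definition sorted_finite :: "'s set \<Rightarrow> ('s \<Rightarrow> 'x set) \<Rightarrow> bool" where
  "sorted_finite S A \<longleftrightarrow> finite (SIGMA s:S. A s)"

definition supp :: "'s set \<Rightarrow> ('s \<Rightarrow> 'x set) \<Rightarrow> 's set" where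
  "supp S A = {s \<in> S. A s \<noteq> {}}"

definition word_prod :: "('s \<Rightarrow> 'a set) \<Rightarrow> 's list \<Rightarrow> 'a list set" where
  "word_prod A w = {xs. list_all2 (\<lambda>x s. x \<in> A s) xs w}"


text \<open>
  An \<open>S\<close>-sorted signature is a family \<open>Sg w s\<close> of sets of operation symbols; only its values for
  \<open>w \<in> lists S\<close> and \<open>s \<in> S\<close> are ever used. The same symbol may occur at several ranks \<open>(w, s)\<close>, so
  operations are indexed by rank and symbol.
\<close>

record ('s, 'f, 'a) algebra =
  car :: "'s \<Rightarrow> 'a set"
  opn :: "'s list \<Rightarrow> 's \<Rightarrow> 'f \<Rightarrow> 'a list \<Rightarrow> 'a"

definition congruence ::
  "'s set \<Rightarrow> ('s list \<Rightarrow> 's \<Rightarrow> 'f set) \<Rightarrow> ('s, 'f, 'a) algebra \<Rightarrow> ('s \<Rightarrow> ('a \<times> 'a) set) \<Rightarrow> bool" where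
  "congruence S Sg \<A> \<Phi> \<longleftrightarrow>
     (\<forall>s\<in>S. equiv (car \<A> s) (\<Phi> s)) \<and> (\<forall>s. s \<notin> S \<longrightarrow> \<Phi> s = {}) \<and>
     (\<forall>w\<in>lists S. \<forall>s\<in>S. \<forall>\<sigma>\<in>Sg w s. \<forall>xs\<in>word_prod (car \<A>) w. \<forall>ys\<in>word_prod (car \<A>) w.
        (\<forall>i<length w. (xs ! i, ys ! i) \<in> \<Phi> (w ! i)) \<longrightarrow>
        (opn \<A> w s \<sigma> xs, opn \<A> w s \<sigma> ys) \<in> \<Phi> s)"

definition Cgr ::
  "'s set \<Rightarrow> ('s list \<Rightarrow> 's \<Rightarrow> 'f set) \<Rightarrow> ('s, 'f, 'a) algebra \<Rightarrow> ('s \<Rightarrow> ('a \<times> 'a) set) set" where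
  "Cgr S Sg \<A> = {\<Phi>. congruence S Sg \<A> \<Phi>}"

definition nabla ::
  "'s set \<Rightarrow> ('s list \<Rightarrow> 's \<Rightarrow> 'f set) \<Rightarrow> ('s, 'f, 'a) algebra \<Rightarrow> 's \<Rightarrow> ('a \<times> 'a) set" where
  "nabla S Sg \<A> = (GREATEST \<Phi>. congruence S Sg \<A> \<Phi>)"

text \<open>
  The elements of \<open>listset Xs\<close> are the lists of representatives of the list of classes \<open>Xs\<close>; for a
  congruence, all of them give the same class below.
\<close>

definition quotient_alg ::
  "('s, 'f, 'a) algebra \<Rightarrow> ('s \<Rightarrow> ('a \<times> 'a) set) \<Rightarrow> ('s, 'f, 'a set) algebra" where
  "quotient_alg \<A> \<Phi> =
     \<lparr>car = (\<lambda>s. car \<A> s // \<Phi> s),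
      opn = (\<lambda>w s \<sigma> Xs. \<Union>xs\<in>listset Xs. \<Phi> s `` {opn \<A> w s \<sigma> xs})\<rparr>"

definition pr :: "('s \<Rightarrow> ('a \<times> 'a) set) \<Rightarrow> 's \<Rightarrow> 'a \<Rightarrow> 'a set" where
  "pr \<Phi> s x = \<Phi> s `` {x}"

definition finite_index ::
  "'s set \<Rightarrow> ('s, 'f, 'a) algebra \<Rightarrow> ('s \<Rightarrow> ('a \<times> 'a) set) \<Rightarrow> bool" where
  "finite_index S \<A> \<Phi> \<longleftrightarrow> sorted_finite S (car (quotient_alg \<A> \<Phi>))"

text \<open>
  Homomorphisms are not required to be extensional: their values off the carrier are arbitrary,
  and neither \<open>epi\<close> nor \<open>Ker\<close> depends on them.
\<close>

definition homs ::
  "'s set \<Rightarrow> ('s list \<Rightarrow> 's \<Rightarrow> 'f set) \<Rightarrow> ('s, 'f, 'a) algebra \<Rightarrow> ('s, 'f, 'b) algebra \<Rightarrow>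
   ('s \<Rightarrow> 'a \<Rightarrow> 'b) set" where
  "homs S Sg \<A> \<B> =
     {f. (\<forall>s\<in>S. f s \<in> car \<A> s \<rightarrow> car \<B> s) \<and>
         (\<forall>w\<in>lists S. \<forall>s\<in>S. \<forall>\<sigma>\<in>Sg w s. \<forall>xs\<in>word_prod (car \<A>) w.
            f s (opn \<A> w s \<sigma> xs) = opn \<B> w s \<sigma> (map2 f w xs))}"

definition epi ::
  "'s set \<Rightarrow> ('s list \<Rightarrow> 's \<Rightarrow> 'f set) \<Rightarrow> ('s, 'f, 'a) algebra \<Rightarrow> ('s, 'f, 'b) algebra \<Rightarrow>
   ('s \<Rightarrow> 'a \<Rightarrow> 'b) \<Rightarrow> bool" where
  "epi S Sg \<A> \<B> f \<longleftrightarrow> f \<in> homs S Sg \<A> \<B> \<and> (\<forall>s\<in>S. f s ` car \<A> s = car \<B> s)"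

definition Ker ::
  "'s set \<Rightarrow> ('s, 'f, 'a) algebra \<Rightarrow> ('s \<Rightarrow> 'a \<Rightarrow> 'b) \<Rightarrow> 's \<Rightarrow> ('a \<times> 'a) set" where
  "Ker S \<A> f s = {(x, y). s \<in> S \<and> x \<in> car \<A> s \<and> y \<in> car \<A> s \<and> f s x = f s y}"


datatype ('s, 'f, 'x) trm =
    Var 's 'x
  | App "'s list" 's 'f "('s, 'f, 'x) trm list"

inductive well_sorted ::
  "'s set \<Rightarrow> ('s list \<Rightarrow> 's \<Rightarrow> 'f set) \<Rightarrow> ('s \<Rightarrow> 'x set) \<Rightarrow> ('s, 'f, 'x) trm \<Rightarrow> 's \<Rightarrow> bool"
  for S Sg A where
  Var: "s \<in> S \<Longrightarrow> x \<in> A s \<Longrightarrow> well_sorted S Sg A (Var s x) s"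
| App: "w \<in> lists S \<Longrightarrow> s \<in> S \<Longrightarrow> \<sigma> \<in> Sg w s \<Longrightarrow> list_all2 (well_sorted S Sg A) ts w \<Longrightarrow>
        well_sorted S Sg A (App w s \<sigma> ts) s"
monos list.rel_mono

text \<open>The free algebra \<open>T\<^sub>\<Sigma>(A)\<close>, realised as the term algebra.\<close>

definition free_alg ::
  "'s set \<Rightarrow> ('s list \<Rightarrow> 's \<Rightarrow> 'f set) \<Rightarrow> ('s \<Rightarrow> 'x set) \<Rightarrow> ('s, 'f, ('s, 'f, 'x) trm) algebra" where
  "free_alg S Sg A = \<lparr>car = (\<lambda>s. {t. well_sorted S Sg A t s}), opn = App\<rparr>"


definition Sat ::
  "'s set \<Rightarrow> ('s, 'f, 'a) algebra \<Rightarrow> ('s \<Rightarrow> ('a \<times> 'a) set) \<Rightarrow> ('s \<Rightarrow> 'a set) set" where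
  "Sat S \<A> \<Phi> =
     {L. (\<forall>s\<in>S. \<exists>C \<subseteq> car \<A> s // \<Phi> s. L s = \<Union>C) \<and> (\<forall>s. s \<notin> S \<longrightarrow> L s = {})}"

definition Omega ::
  "'s set \<Rightarrow> ('s list \<Rightarrow> 's \<Rightarrow> 'f set) \<Rightarrow> ('s, 'f, 'a) algebra \<Rightarrow> ('s \<Rightarrow> 'a set) \<Rightarrow>
   's \<Rightarrow> ('a \<times> 'a) set" where
  "Omega S Sg \<A> L = (GREATEST \<Phi>. congruence S Sg \<A> \<Phi> \<and> L \<in> Sat S \<A> \<Phi>)"

definition Lang_r ::
  "'s set \<Rightarrow> ('s list \<Rightarrow> 's \<Rightarrow> 'f set) \<Rightarrow> ('s, 'f, 'a) algebra \<Rightarrow> ('s \<Rightarrow> 'a set) set" where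
  "Lang_r S Sg \<A> =
     {L. (\<forall>s\<in>S. L s \<subseteq> car \<A> s) \<and> (\<forall>s. s \<notin> S \<longrightarrow> L s = {}) \<and>
         finite_index S \<A> (Omega S Sg \<A> L)}"


definition cgr_filter ::
  "'s set \<Rightarrow> ('s list \<Rightarrow> 's \<Rightarrow> 'f set) \<Rightarrow> ('s, 'f, 'a) algebra \<Rightarrow> ('s \<Rightarrow> ('a \<times> 'a) set) set \<Rightarrow> bool" where
  "cgr_filter S Sg \<A> F \<longleftrightarrow>
     F \<subseteq> Cgr S Sg \<A> \<and> F \<noteq> {} \<and>
     (\<forall>\<Phi>\<in>F. \<forall>\<Psi>\<in>F. (\<lambda>s. \<Phi> s \<inter> \<Psi> s) \<in> F) \<and>
     (\<forall>\<Phi>\<in>F. \<forall>\<Psi>\<in>Cgr S Sg \<A>. \<Phi> \<le> \<Psi> \<longrightarrow> \<Psi> \<in> F)"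

text \<open>
  A formation is a function with domain \<open>sorted_sets U S\<close>; extensionality makes equality of
  formations agree with equality on that domain.
\<close>

definition formation_cgr_fi ::
  "'x set set \<Rightarrow> 's set \<Rightarrow> ('s list \<Rightarrow> 's \<Rightarrow> 'f set) \<Rightarrow>
   (('s \<Rightarrow> 'x set) \<Rightarrow> ('s \<Rightarrow> (('s, 'f, 'x) trm \<times> ('s, 'f, 'x) trm) set) set) \<Rightarrow> bool" where
  "formation_cgr_fi U S Sg \<FF> \<longleftrightarrow>
     \<FF> \<in> extensional (sorted_sets U S) \<and>
     (\<forall>A\<in>sorted_sets U S.
        cgr_filter S Sg (free_alg S Sg A) (\<FF> A) \<and>
        (\<forall>\<Phi>\<in>\<FF> A. finite_index S (free_alg S Sg A) \<Phi>)) \<and>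
     (\<forall>A\<in>sorted_sets U S. \<forall>B\<in>sorted_sets U S. \<forall>\<Theta>\<in>\<FF> B.
        \<forall>f\<in>homs S Sg (free_alg S Sg A) (free_alg S Sg B).
        epi S Sg (free_alg S Sg A) (quotient_alg (free_alg S Sg B) \<Theta>) (\<lambda>s. pr \<Theta> s \<circ> f s) \<longrightarrow>
        Ker S (free_alg S Sg A) (\<lambda>s. pr \<Theta> s \<circ> f s) \<in> \<FF> A)"

definition formation_lang_r ::
  "'x set set \<Rightarrow> 's set \<Rightarrow> ('s list \<Rightarrow> 's \<Rightarrow> 'f set) \<Rightarrow>
   (('s \<Rightarrow> 'x set) \<Rightarrow> ('s \<Rightarrow> ('s, 'f, 'x) trm set) set) \<Rightarrow> bool" where
  "formation_lang_r U S Sg \<L> \<longleftrightarrow>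
     \<L> \<in> extensional (sorted_sets U S) \<and>
     (\<forall>A\<in>sorted_sets U S. \<L> A \<subseteq> Lang_r S Sg (free_alg S Sg A)) \<and>
     (\<forall>A\<in>sorted_sets U S. Sat S (free_alg S Sg A) (nabla S Sg (free_alg S Sg A)) \<subseteq> \<L> A) \<and>
     (\<forall>A\<in>sorted_sets U S. \<forall>L\<in>\<L> A. \<forall>L'\<in>\<L> A.
        Sat S (free_alg S Sg A)
          (\<lambda>s. Omega S Sg (free_alg S Sg A) L s \<inter> Omega S Sg (free_alg S Sg A) L' s) \<subseteq> \<L> A) \<and>
     (\<forall>A\<in>sorted_sets U S. \<forall>B\<in>sorted_sets U S. \<forall>M\<in>\<L> B.
        \<forall>f\<in>homs S Sg (free_alg S Sg A) (free_alg S Sg B).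
        (let \<Theta> = Omega S Sg (free_alg S Sg B) M; g = (\<lambda>s. pr \<Theta> s \<circ> f s) in
          epi S Sg (free_alg S Sg A) (quotient_alg (free_alg S Sg B) \<Theta>) g \<longrightarrow>
          Sat S (free_alg S Sg A) (Ker S (free_alg S Sg A) g) \<subseteq> \<L> A))"

definition Form_Cgr_fi ::
  "'x set set \<Rightarrow> 's set \<Rightarrow> ('s list \<Rightarrow> 's \<Rightarrow> 'f set) \<Rightarrow>
   (('s \<Rightarrow> 'x set) \<Rightarrow> ('s \<Rightarrow> (('s, 'f, 'x) trm \<times> ('s, 'f, 'x) trm) set) set) gorder" where
  "Form_Cgr_fi U S Sg =
     \<lparr>carrier = {\<FF>. formation_cgr_fi U S Sg \<FF>},
      eq = (=),
      le = (\<lambda>\<FF> \<GG>. \<forall>A\<in>sorted_sets U S. \<FF> A \<subseteq> \<GG> A)\<rparr>"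

definition Form_Lang_r ::
  "'x set set \<Rightarrow> 's set \<Rightarrow> ('s list \<Rightarrow> 's \<Rightarrow> 'f set) \<Rightarrow>
   (('s \<Rightarrow> 'x set) \<Rightarrow> ('s \<Rightarrow> ('s, 'f, 'x) trm set) set) gorder" where
  "Form_Lang_r U S Sg =
     \<lparr>carrier = {\<L>. formation_lang_r U S Sg \<L>},
      eq = (=),
      le = (\<lambda>\<L> \<M>. \<forall>A\<in>sorted_sets U S. \<L> A \<subseteq> \<M> A)\<rparr>"

text \<open>For complete lattices, an order isomorphism preserves all joins and meets.\<close>

definition lattice_isomorphic :: "'a gorder \<Rightarrow> 'b gorder \<Rightarrow> bool" where
  "lattice_isomorphic P Q \<longleftrightarrow>
     (\<exists>h. bij_betw h (carrier P) (carrier Q) \<and>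
          (\<forall>x\<in>carrier P. \<forall>y\<in>carrier P. x \<sqsubseteq>\<^bsub>P\<^esub> y \<longleftrightarrow> h x \<sqsubseteq>\<^bsub>Q\<^esub> h y))"

end

theory Submission
  imports Defs
begin

text \<open>
  A filter \<open>F\<close> of finite index congruences is sent to the languages saturated by one of its members,
  and a family \<open>Ls\<close> of languages to the finite index congruences all of whose saturated languages lie
  in \<open>Ls\<close>. These maps are mutually inverse on each free algebra: a finite index congruence is the
  intersection of the finitely many syntactic congruences of its classes, while conditions (1) and (2)
  make \<open>Ls\<close> closed under finite unions and intersections, and a saturated language is a finite union
  of classes. The condition on homomorphisms transfers because, for the syntactic congruence \<open>\<Omega>\<close> of
  a class of \<open>\<Theta>\<close>, the projection modulo \<open>\<Omega>\<close> factors through the one modulo \<open>\<Theta>\<close>. Finiteness of the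
  set of sorts makes the greatest congruence, and with it some filter, have finite index.
\<close>

section \<open>Congruences, saturation and the syntactic congruence\<close>

text \<open>Conversely, take all classes contained in \<open>X\<close>: every point of
  \<open>X\<close> lies in its own class, and closure keeps that class inside \<open>X\<close>.
  Saturation thus becomes a closure condition, with no choice of classes left in it.\<close>

lemma Union_of_classes_iff:
  assumes "equiv A R"
  shows "(\<exists>C \<subseteq> A // R. X = \<Union>C) \<longleftrightarrow> X \<subseteq> A \<and> (\<forall>x y. (x, y) \<in> R \<longrightarrow> x \<in> X \<longrightarrow> y \<in> X)"
    (is "?l \<longleftrightarrow> ?r")
proof
  assume ?l
  then show ?r
    using in_quotient_imp_subset[OF assms] in_quotient_imp_closed[OF assms] by blast
next
  assume r: ?r
  have "X = \<Union>{c \<in> A // R. c \<subseteq> X}"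
  proof (intro equalityI subsetI)
    fix x assume x: "x \<in> X"
    with r have "x \<in> A" by blast
    then have "R `` {x} \<in> A // R" "x \<in> R `` {x}"
      using equiv_class_self[OF assms] by (auto intro: quotientI)
    moreover have "R `` {x} \<subseteq> X" using r x by blast
    ultimately show "x \<in> \<Union>{c \<in> A // R. c \<subseteq> X}" by blast
  qed blast
  then show ?l by (intro exI[of _ "{c \<in> A // R. c \<subseteq> X}"]) auto
qed

text \<open>What remains of membership in \<open>Lang_r\<close> when regularity is dropped.\<close>

definition sorted_subset :: "'s set \<Rightarrow> ('s \<Rightarrow> 'a set) \<Rightarrow> ('s \<Rightarrow> 'a set) \<Rightarrow> bool" where
  "sorted_subset S A L \<longleftrightarrow> (\<forall>s\<in>S. L s \<subseteq> A s) \<and> (\<forall>s. s \<notin> S \<longrightarrow> L s = {})"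

lemma congruence_equiv: "congruence S Sg \<A> \<Phi> \<Longrightarrow> s \<in> S \<Longrightarrow> equiv (car \<A> s) (\<Phi> s)"
  by (simp add: congruence_def)

lemma Sat_iff:
  assumes "congruence S Sg \<A> \<Phi>"
  shows "L \<in> Sat S \<A> \<Phi> \<longleftrightarrow>
    sorted_subset S (car \<A>) L \<and> (\<forall>s\<in>S. \<forall>x y. (x, y) \<in> \<Phi> s \<longrightarrow> x \<in> L s \<longrightarrow> y \<in> L s)"
  unfolding Sat_def sorted_subset_def
  using Union_of_classes_iff[OF congruence_equiv[OF assms]] by auto

lemma SatI:
  assumes "congruence S Sg \<A> \<Phi>" "sorted_subset S (car \<A>) L"
    "\<And>s x y. s \<in> S \<Longrightarrow> (x, y) \<in> \<Phi> s \<Longrightarrow> x \<in> L s \<Longrightarrow> y \<in> L s"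
  shows "L \<in> Sat S \<A> \<Phi>"
  using assms by (simp add: Sat_iff)

lemma SatD:
  assumes "congruence S Sg \<A> \<Phi>" "L \<in> Sat S \<A> \<Phi>"
  shows "sorted_subset S (car \<A>) L"
    and "s \<in> S \<Longrightarrow> (x, y) \<in> \<Phi> s \<Longrightarrow> x \<in> L s \<Longrightarrow> y \<in> L s"
  using assms by (auto simp: Sat_iff)

lemma Sat_antimono:
  assumes "congruence S Sg \<A> \<Phi>" "congruence S Sg \<A> \<Psi>" "\<Phi> \<le> \<Psi>"
  shows "Sat S \<A> \<Psi> \<subseteq> Sat S \<A> \<Phi>"
  unfolding subset_iff Sat_iff[OF assms(1)] Sat_iff[OF assms(2)]
  using assms(3) unfolding le_fun_def by blast

lemma congruence_Int:
  assumes "congruence S Sg \<A> \<Phi>" "congruence S Sg \<A> \<Psi>"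
  shows "congruence S Sg \<A> (\<lambda>s. \<Phi> s \<inter> \<Psi> s)"
proof -
  have "equiv (car \<A> s) (\<Phi> s \<inter> \<Psi> s)" if "s \<in> S" for s
    using congruence_equiv[OF assms(1) that] congruence_equiv[OF assms(2) that]
    by (auto simp: equiv_def refl_on_def intro: sym_Int trans_Int)
  with assms show ?thesis unfolding congruence_def by auto
qed

lemma finite_index_iff:
  assumes "finite S"
  shows "finite_index S \<A> \<Phi> \<longleftrightarrow> (\<forall>s\<in>S. finite (car \<A> s // \<Phi> s))"
proof
  assume "finite_index S \<A> \<Phi>"
  then have "finite (SIGMA s:S. car \<A> s // \<Phi> s)"
    by (simp add: finite_index_def sorted_finite_def quotient_alg_def)
  moreover have "car \<A> s // \<Phi> s \<subseteq> snd ` (SIGMA s:S. car \<A> s // \<Phi> s)" if "s \<in> S" for s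
    using that by force
  ultimately show "\<forall>s\<in>S. finite (car \<A> s // \<Phi> s)"
    by (meson finite_imageI finite_subset)
next
  assume "\<forall>s\<in>S. finite (car \<A> s // \<Phi> s)"
  then show "finite_index S \<A> \<Phi>"
    using assms by (auto simp: finite_index_def sorted_finite_def quotient_alg_def)
qed

lemma finite_index_mono:
  assumes "finite S" "congruence S Sg \<A> \<Phi>" "congruence S Sg \<A> \<Psi>" "\<Phi> \<le> \<Psi>"
    "finite_index S \<A> \<Phi>"
  shows "finite_index S \<A> \<Psi>"
  unfolding finite_index_iff[OF assms(1)]
proof
  fix s assume s: "s \<in> S"
  show "finite (car \<A> s // \<Psi> s)"
    using finite_refines_finite[OF _ _ congruence_equiv[OF assms(2) s] congruence_equiv[OF assms(3) s]]
      assms(4,5) s by (simp add: finite_index_iff[OF assms(1)] le_fun_def)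
qed

text \<open>The class of a point modulo the intersection is the intersection of its two classes, so
  each sort has at most as many classes as there are pairs of classes.\<close>

lemma finite_index_Int:
  assumes "finite S" "finite_index S \<A> \<Phi>" "finite_index S \<A> \<Psi>"
  shows "finite_index S \<A> (\<lambda>s. \<Phi> s \<inter> \<Psi> s)"
  unfolding finite_index_iff[OF assms(1)]
proof
  fix s assume s: "s \<in> S"
  have "car \<A> s // (\<Phi> s \<inter> \<Psi> s) \<subseteq> (\<lambda>(C, D). C \<inter> D) ` ((car \<A> s // \<Phi> s) \<times> (car \<A> s // \<Psi> s))"
  proof
    fix X assume "X \<in> car \<A> s // (\<Phi> s \<inter> \<Psi> s)"
    then obtain x where x: "x \<in> car \<A> s" "X = (\<Phi> s \<inter> \<Psi> s) `` {x}" by (rule quotientE)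
    then have "X = \<Phi> s `` {x} \<inter> \<Psi> s `` {x}" by auto
    with x show "X \<in> (\<lambda>(C, D). C \<inter> D) ` ((car \<A> s // \<Phi> s) \<times> (car \<A> s // \<Psi> s))"
      by (auto intro!: image_eqI[of _ _ "(\<Phi> s `` {x}, \<Psi> s `` {x})"] quotientI)
  qed
  then show "finite (car \<A> s // (\<Phi> s \<inter> \<Psi> s))"
    using assms s by (auto simp: finite_index_iff intro: finite_subset)
qed

text \<open>
  Requiring stability only under the substitution of a single argument makes the relation visibly
  closed under transitivity; compatibility then follows by exchanging the arguments one at a time.
\<close>

coinductive indistinguishable ::
  "'s set \<Rightarrow> ('s list \<Rightarrow> 's \<Rightarrow> 'f set) \<Rightarrow> ('s, 'f, 'a) algebra \<Rightarrow> ('s \<Rightarrow> 'a set) \<Rightarrow>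
   's \<Rightarrow> 'a \<Rightarrow> 'a \<Rightarrow> bool"
  for S Sg \<A> L where
  "\<lbrakk>s \<in> S; x \<in> car \<A> s; y \<in> car \<A> s; x \<in> L s \<longleftrightarrow> y \<in> L s;
    \<forall>v w t \<sigma> us us'. v @ s # w \<in> lists S \<longrightarrow> t \<in> S \<longrightarrow> \<sigma> \<in> Sg (v @ s # w) t \<longrightarrow>
      us \<in> word_prod (car \<A>) v \<longrightarrow> us' \<in> word_prod (car \<A>) w \<longrightarrow>
      indistinguishable S Sg \<A> L t
        (opn \<A> (v @ s # w) t \<sigma> (us @ x # us')) (opn \<A> (v @ s # w) t \<sigma> (us @ y # us'))\<rbrakk>
   \<Longrightarrow> indistinguishable S Sg \<A> L s x y"

lemma word_prod_append_Cons:
  assumes "us \<in> word_prod A v" "x \<in> A s" "us' \<in> word_prod A w"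
  shows "us @ x # us' \<in> word_prod A (v @ s # w)"
  using assms by (auto simp: word_prod_def intro: list_all2_appendI)

lemma word_prodD:
  assumes "xs \<in> word_prod A w"
  shows "length xs = length w" and "i < length w \<Longrightarrow> xs ! i \<in> A (w ! i)"
  using assms by (auto simp: word_prod_def list_all2_conv_all_nth)

section \<open>The syntactic congruence of a sorted language\<close>

locale sorted_algebra =
  fixes S :: "'s set" and Sg :: "'s list \<Rightarrow> 's \<Rightarrow> 'f set" and \<A> :: "('s, 'f, 'a) algebra"
  assumes opn_closed: "w \<in> lists S \<Longrightarrow> s \<in> S \<Longrightarrow> \<sigma> \<in> Sg w s \<Longrightarrow> xs \<in> word_prod (car \<A>) w \<Longrightarrow>
    opn \<A> w s \<sigma> xs \<in> car \<A> s"
begin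

abbreviation indist where "indist \<equiv> indistinguishable S Sg \<A>"

lemma indist_refl:
  assumes "s \<in> S" "x \<in> car \<A> s"
  shows "indist L s x x"
  using assms
proof (coinduction arbitrary: s x)
  case indistinguishable
  then show ?case
    by (auto intro!: opn_closed word_prod_append_Cons)
qed

lemma indist_sym: "indist L s x y \<Longrightarrow> indist L s y x"
proof (coinduction arbitrary: s x y)
  case indistinguishable
  then show ?case
    by cases simp
qed

text \<open>The relation composed with itself is again closed under the rule: putting
  \<open>y\<close> into the exchanged slot gives the middle term for every pair of substituted
  operations.\<close>

lemma indist_trans: "indist L s x y \<Longrightarrow> indist L s y z \<Longrightarrow> indist L s x z"
proof (coinduction arbitrary: s x y z)
  case indistinguishable
  from indistinguishable(1) show ?case
  proof cases
    case 1
    note xy = this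
    from indistinguishable(2) show ?thesis
    proof cases
      case 1
      then show ?thesis using xy by (simp; blast)
    qed
  qed
qed

text \<open>Induction on the part \<open>w\<close> of the word whose arguments are still to be
  exchanged; \<open>v\<close> and \<open>us\<close> carry the prefix, where the exchange is already
  done.\<close>

lemma indist_opn:
  assumes "v @ w \<in> lists S" "s \<in> S" "\<sigma> \<in> Sg (v @ w) s" "us \<in> word_prod (car \<A>) v"
    "xs \<in> word_prod (car \<A>) w" "ys \<in> word_prod (car \<A>) w"
    "\<forall>i<length w. indist L (w ! i) (xs ! i) (ys ! i)"
  shows "indist L s (opn \<A> (v @ w) s \<sigma> (us @ xs)) (opn \<A> (v @ w) s \<sigma> (us @ ys))"
  using assms
proof (induction w arbitrary: v us xs ys)
  case Nil
  then show ?case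
    by (auto simp: word_prod_def intro!: indist_refl opn_closed)
next
  case (Cons t w)
  from Cons.prems(5,6) obtain x xs' y ys' where xs: "xs = x # xs'" and ys: "ys = y # ys'"
    and mem: "x \<in> car \<A> t" "y \<in> car \<A> t" "xs' \<in> word_prod (car \<A>) w" "ys' \<in> word_prod (car \<A>) w"
    by (auto simp: word_prod_def list_all2_Cons2)
  have "indist L t x y" using Cons.prems(7) xs ys by force
  \<comment> \<open>The defining rule exchanges the first remaining argument; the induction
    hypothesis, with \<open>y\<close> moved into the prefix, exchanges the others.\<close>
  then have 1: "indist L s (opn \<A> (v @ t # w) s \<sigma> (us @ x # xs')) (opn \<A> (v @ t # w) s \<sigma> (us @ y # xs'))"
    by cases (use Cons.prems mem in blast)
  have "us @ [y] \<in> word_prod (car \<A>) (v @ [t])"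
    using Cons.prems(4) mem by (auto simp: word_prod_def intro: list_all2_appendI)
  moreover have "\<forall>i<length w. indist L (w ! i) (xs' ! i) (ys' ! i)"
    using Cons.prems(7) xs ys by force
  ultimately have 2: "indist L s (opn \<A> (v @ t # w) s \<sigma> (us @ y # xs')) (opn \<A> (v @ t # w) s \<sigma> (us @ y # ys'))"
    using Cons.IH[of "v @ [t]" "us @ [y]" xs' ys'] Cons.prems(1-3) mem by simp
  show ?case using indist_trans[OF 1 2] xs ys by simp
qed

text \<open>A greatest fixed point: the coarsest relation that does not separate \<open>L\<close>
  and is stable under exchanging one argument. The next lemmas identify it with the syntactic
  congruence of \<open>L\<close>.\<close>

definition synt :: "('s \<Rightarrow> 'a set) \<Rightarrow> 's \<Rightarrow> ('a \<times> 'a) set" where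
  "synt L s = {(x, y). indist L s x y}"

lemma synt_congruence: "congruence S Sg \<A> (synt L)"
proof -
  have car: "s \<in> S \<and> x \<in> car \<A> s \<and> y \<in> car \<A> s" if "indist L s x y" for s x y
    using that by cases simp
  have "equiv (car \<A> s) (synt L s)" if "s \<in> S" for s
  proof (rule equivI)
    show "trans (synt L s)"
      unfolding trans_def synt_def using indist_trans by blast
  qed (use that car indist_refl indist_sym in \<open>auto simp: synt_def refl_on_def sym_def\<close>)
  moreover have "synt L s = {}" if "s \<notin> S" for s
    using that car by (auto simp: synt_def)
  \<comment> \<open>Compatibility in all arguments at once is \<open>indist_opn\<close> with an
    empty prefix, for which the only argument list is \<open>[]\<close>.\<close>
  moreover have "word_prod (car \<A>) [] = {[]}"
    by (auto simp: word_prod_def)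
  ultimately show ?thesis
    unfolding congruence_def using indist_opn[of "[]" _ _ _ "[]"] by (auto simp: synt_def)
qed

lemma synt_saturates:
  assumes "sorted_subset S (car \<A>) L"
  shows "L \<in> Sat S \<A> (synt L)"
  using synt_congruence assms
proof (rule SatI)
  fix s x y assume "(x, y) \<in> synt L s" "x \<in> L s"
  then have "indist L s x y" by (simp add: synt_def)
  then show "y \<in> L s" by cases (use \<open>x \<in> L s\<close> in blast)
qed

text \<open>By coinduction with \<Phi> itself: saturation gives agreement on \<open>L\<close>, and
  compatibility together with reflexivity at the other positions gives stability under exchanging
  one argument.\<close>

lemma synt_greatest:
  assumes "congruence S Sg \<A> \<Phi>" "L \<in> Sat S \<A> \<Phi>"
  shows "\<Phi> \<le> synt L"
proof (intro le_funI subsetI)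
  fix s p assume "p \<in> \<Phi> s"
  then obtain x y where p: "p = (x, y)" and xy: "(x, y) \<in> \<Phi> s" by (cases p) auto
  have "indist L s x y" using xy
  proof (coinduction arbitrary: s x y)
    case indistinguishable
    have s: "s \<in> S" using indistinguishable assms(1) by (auto simp: congruence_def)
    have eq: "equiv (car \<A> s) (\<Phi> s)" using congruence_equiv[OF assms(1) s] .
    have mem: "x \<in> car \<A> s" "y \<in> car \<A> s"
      using eq indistinguishable by (meson equiv_class_eq_iff)+
    have "(y, x) \<in> \<Phi> s" using eq indistinguishable by (meson equivE symE)
    then have iff: "x \<in> L s \<longleftrightarrow> y \<in> L s"
      using SatD(2)[OF assms s] indistinguishable by blast
    have step: "(opn \<A> (v @ s # w) t \<sigma> (us @ x # us'), opn \<A> (v @ s # w) t \<sigma> (us @ y # us')) \<in> \<Phi> t"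
      if *: "v @ s # w \<in> lists S" "t \<in> S" "\<sigma> \<in> Sg (v @ s # w) t"
        "us \<in> word_prod (car \<A>) v" "us' \<in> word_prod (car \<A>) w" for v w t \<sigma> us us'
    proof -
      \<comment> \<open>The two argument lists differ only at position \<open>length v\<close>,
        where the pair is the given one; elsewhere the entries coincide, and reflexivity applies
        since they lie in the carrier.\<close>
      have "(((us @ x # us') ! i), ((us @ y # us') ! i)) \<in> \<Phi> ((v @ s # w) ! i)"
        if i: "i < length (v @ s # w)" for i
      proof (cases "i = length v")
        case True
        then show ?thesis using indistinguishable word_prodD(1)[OF *(4)]
          by (simp add: nth_append)
      next
        case False
        then have "(us @ x # us') ! i = (us @ y # us') ! i"
          using word_prodD(1)[OF *(4)] by (auto simp: nth_append nth_Cons')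
        moreover have "(us @ y # us') ! i \<in> car \<A> ((v @ s # w) ! i)"
          using word_prodD(2)[OF word_prod_append_Cons[OF *(4) mem(2) *(5)] i] .
        moreover have "(v @ s # w) ! i \<in> S"
          using *(1) i nth_mem[OF i] by (auto simp: lists_eq_set simp del: nth_mem)
        ultimately show ?thesis
          using congruence_equiv[OF assms(1)] by (metis equivE refl_onD)
      qed
      then show ?thesis
        using assms(1) * word_prod_append_Cons[OF *(4) mem(1) *(5)]
          word_prod_append_Cons[OF *(4) mem(2) *(5)]
        unfolding congruence_def by blast
    qed
    show ?case
      using s mem iff step by blast
  qed
  then show "p \<in> synt L s" by (simp add: p synt_def)
qed

text \<open>\<open>Omega\<close> is given by \<open>GREATEST\<close>, which says something only once
  a greatest such congruence is exhibited; \<open>synt L\<close> is that witness.\<close>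

lemma Omega_eq_synt: "sorted_subset S (car \<A>) L \<Longrightarrow> Omega S Sg \<A> L = synt L"
  unfolding Omega_def
  by (rule Greatest_equality) (auto intro: synt_congruence synt_saturates synt_greatest)

text \<open>The full relation on each sort is compatible because the operations stay in the carrier,
  and every congruence lies inside it.\<close>

lemma nabla_eq: "nabla S Sg \<A> = (\<lambda>s. if s \<in> S then car \<A> s \<times> car \<A> s else {})"
  unfolding nabla_def
proof (rule Greatest_equality)
  show "congruence S Sg \<A> (\<lambda>s. if s \<in> S then car \<A> s \<times> car \<A> s else {})"
    unfolding congruence_def
    by (auto intro!: equivI opn_closed simp: refl_on_def sym_def trans_def)
next
  fix \<Phi> assume "congruence S Sg \<A> \<Phi>"
  then show "\<Phi> \<le> (\<lambda>s. if s \<in> S then car \<A> s \<times> car \<A> s else {})"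
    by (auto simp: congruence_def le_fun_def equiv_def)
qed

lemma nabla_congruence: "congruence S Sg \<A> (nabla S Sg \<A>)"
  unfolding congruence_def nabla_eq
  by (auto intro!: equivI opn_closed simp: refl_on_def sym_def trans_def)

lemma nabla_greatest: "congruence S Sg \<A> \<Phi> \<Longrightarrow> \<Phi> \<le> nabla S Sg \<A>"
  by (auto simp: nabla_eq congruence_def le_fun_def equiv_def)

lemma Omega_congruence: "sorted_subset S (car \<A>) L \<Longrightarrow> congruence S Sg \<A> (Omega S Sg \<A> L)"
  by (simp add: Omega_eq_synt synt_congruence)

lemma Omega_saturates: "sorted_subset S (car \<A>) L \<Longrightarrow> L \<in> Sat S \<A> (Omega S Sg \<A> L)"
  by (simp add: Omega_eq_synt synt_saturates)

lemma Omega_closed: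
  assumes "sorted_subset S (car \<A>) L" "s \<in> S" "(x, y) \<in> Omega S Sg \<A> L s" "x \<in> L s"
  shows "y \<in> L s"
  using SatD(2)[OF Omega_congruence[OF assms(1)] Omega_saturates[OF assms(1)]] assms(2-4) by blast

lemma Omega_greatest:
  assumes "congruence S Sg \<A> \<Phi>" "L \<in> Sat S \<A> \<Phi>"
  shows "\<Phi> \<le> Omega S Sg \<A> L"
  using synt_greatest[OF assms] Omega_eq_synt[OF SatD(1)[OF assms]] by simp

end


section \<open>Filters of congruences and families of languages of one algebra\<close>

text \<open>Lets a class, which lives in one sort, be treated as a sorted language.\<close>

definition single :: "'s \<Rightarrow> 'a set \<Rightarrow> 's \<Rightarrow> 'a set" where
  "single s C t = (if t = s then C else {})"

lemma single_class_saturated: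
  assumes "congruence S Sg \<A> \<Phi>" "s \<in> S" "C \<in> car \<A> s // \<Phi> s"
  shows "single s C \<in> Sat S \<A> \<Phi>"
  using assms(1)
proof (rule SatI)
  show "sorted_subset S (car \<A>) (single s C)"
    using assms(2) in_quotient_imp_subset[OF congruence_equiv[OF assms(1,2)] assms(3)]
    by (auto simp: sorted_subset_def single_def)
next
  fix t x y assume "(x, y) \<in> \<Phi> t" "x \<in> single s C t"
  then show "y \<in> single s C t"
    using in_quotient_imp_closed[OF congruence_equiv[OF assms(1,2)] assms(3)]
    by (auto simp: single_def split: if_splits)
qed

text \<open>The part of the definition of a formation of congruences that speaks of one algebra,
  separated so that the correspondence can be proved algebra by algebra.\<close>

definition fi_filter ::
  "'s set \<Rightarrow> ('s list \<Rightarrow> 's \<Rightarrow> 'f set) \<Rightarrow> ('s, 'f, 'a) algebra \<Rightarrow> ('s \<Rightarrow> ('a \<times> 'a) set) set \<Rightarrow> bool" where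
  "fi_filter S Sg \<A> F \<longleftrightarrow> cgr_filter S Sg \<A> F \<and> (\<forall>\<Phi>\<in>F. finite_index S \<A> \<Phi>)"

text \<open>Likewise for formations of languages: regularity and the first two closure
  conditions.\<close>

definition language_family ::
  "'s set \<Rightarrow> ('s list \<Rightarrow> 's \<Rightarrow> 'f set) \<Rightarrow> ('s, 'f, 'a) algebra \<Rightarrow> ('s \<Rightarrow> 'a set) set \<Rightarrow> bool" where
  "language_family S Sg \<A> Ls \<longleftrightarrow>
     Ls \<subseteq> Lang_r S Sg \<A> \<and> Sat S \<A> (nabla S Sg \<A>) \<subseteq> Ls \<and>
     (\<forall>L\<in>Ls. \<forall>L'\<in>Ls. Sat S \<A> (\<lambda>s. Omega S Sg \<A> L s \<inter> Omega S Sg \<A> L' s) \<subseteq> Ls)"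

definition languages ::
  "'s set \<Rightarrow> ('s, 'f, 'a) algebra \<Rightarrow> ('s \<Rightarrow> ('a \<times> 'a) set) set \<Rightarrow> ('s \<Rightarrow> 'a set) set" where
  "languages S \<A> F = (\<Union>\<Phi>\<in>F. Sat S \<A> \<Phi>)"

definition congruences ::
  "'s set \<Rightarrow> ('s list \<Rightarrow> 's \<Rightarrow> 'f set) \<Rightarrow> ('s, 'f, 'a) algebra \<Rightarrow> ('s \<Rightarrow> 'a set) set \<Rightarrow>
   ('s \<Rightarrow> ('a \<times> 'a) set) set" where
  "congruences S Sg \<A> Ls = {\<Phi> \<in> Cgr S Sg \<A>. finite_index S \<A> \<Phi> \<and> Sat S \<A> \<Phi> \<subseteq> Ls}"

locale finite_sorted_algebra = sorted_algebra +
  assumes finite_S: "finite S"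
begin

text \<open>There is at most one class in each sort, and \<open>S\<close> is finite.\<close>

lemma nabla_finite_index: "finite_index S \<A> (nabla S Sg \<A>)"
proof -
  have "car \<A> s // (car \<A> s \<times> car \<A> s) \<subseteq> {car \<A> s}" for s
    by (auto simp: quotient_def)
  then show ?thesis
    by (auto simp: finite_index_iff[OF finite_S] nabla_eq intro: finite_subset)
qed

section \<open>From families of languages to filters of congruences\<close>

context
  fixes Ls assumes Ls: "language_family S Sg \<A> Ls"
begin

lemma language_family_sorted: "L \<in> Ls \<Longrightarrow> sorted_subset S (car \<A>) L"
  using Ls by (auto simp: language_family_def Lang_r_def sorted_subset_def)

text \<open>Condition (2) on languages with saturation unfolded: a language need only respect the
  pairs lying in both syntactic congruences.\<close>

lemma language_family_saturated:
  assumes "L \<in> Ls" "L' \<in> Ls" "sorted_subset S (car \<A>) K"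
    and "\<And>s x y. \<lbrakk>s \<in> S; (x, y) \<in> Omega S Sg \<A> L s; (x, y) \<in> Omega S Sg \<A> L' s; x \<in> K s\<rbrakk> \<Longrightarrow> y \<in> K s"
  shows "K \<in> Ls"
proof -
  have "K \<in> Sat S \<A> (\<lambda>s. Omega S Sg \<A> L s \<inter> Omega S Sg \<A> L' s)"
    using assms(3,4)
    by (intro SatI[OF congruence_Int[OF assms(1,2)[THEN language_family_sorted, THEN Omega_congruence]]])
      auto
  then show ?thesis using Ls assms(1,2) unfolding language_family_def by blast
qed

text \<open>A pair in both syntactic congruences preserves membership in \<open>L\<close> and in
  \<open>L'\<close>, hence in their union. The intersection is handled the same way.\<close>

lemma language_family_Un:
  assumes "L \<in> Ls" "L' \<in> Ls"
  shows "(\<lambda>s. L s \<union> L' s) \<in> Ls"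
proof (rule language_family_saturated[OF assms])
  note sorted = assms[THEN language_family_sorted]
  show "sorted_subset S (car \<A>) (\<lambda>s. L s \<union> L' s)"
    using sorted by (auto simp: sorted_subset_def)
  show "y \<in> L s \<union> L' s" if "s \<in> S" "(x, y) \<in> Omega S Sg \<A> L s"
    "(x, y) \<in> Omega S Sg \<A> L' s" "x \<in> L s \<union> L' s" for s x y
    using that sorted[THEN Omega_closed] by blast
qed

lemma language_family_Int:
  assumes "L \<in> Ls" "L' \<in> Ls"
  shows "(\<lambda>s. L s \<inter> L' s) \<in> Ls"
proof (rule language_family_saturated[OF assms])
  note sorted = assms[THEN language_family_sorted]
  show "sorted_subset S (car \<A>) (\<lambda>s. L s \<inter> L' s)"
    using sorted by (auto simp: sorted_subset_def)
  show "y \<in> L s \<inter> L' s" if "s \<in> S" "(x, y) \<in> Omega S Sg \<A> L s"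
    "(x, y) \<in> Omega S Sg \<A> L' s" "x \<in> L s \<inter> L' s" for s x y
    using that sorted[THEN Omega_closed] by blast
qed

text \<open>A saturated language is the union of the classes it contains, seen as languages in one
  sort; finite index makes this a finite union, so it suffices that each class gives a member of
  \<open>Ls\<close>.\<close>

lemma Sat_subset_language_family:
  assumes "congruence S Sg \<A> \<Phi>" "finite_index S \<A> \<Phi>"
    and cls: "\<And>s C. s \<in> S \<Longrightarrow> C \<in> car \<A> s // \<Phi> s \<Longrightarrow> single s C \<in> Ls"
  shows "Sat S \<A> \<Phi> \<subseteq> Ls"
proof
  fix K assume K: "K \<in> Sat S \<A> \<Phi>"
  have un: "(\<lambda>t. \<Union>{C. (t, C) \<in> I}) \<in> Ls" if "finite I" "I \<subseteq> (SIGMA s:S. car \<A> s // \<Phi> s)" for I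
    using that
  proof (induction I)
    case empty
    \<comment> \<open>The union of no classes is the empty language, which is saturated for every
      congruence and so enters \<open>Ls\<close> by condition (1).\<close>
    have "(\<lambda>t. {}) \<in> Sat S \<A> (nabla S Sg \<A>)"
      by (rule SatI[OF nabla_congruence]) (auto simp: sorted_subset_def)
    then show ?case using Ls by (auto simp: language_family_def)
  next
    case (insert p I)
    obtain s C where p: "p = (s, C)" by (cases p)
    have "(\<lambda>t. single s C t \<union> \<Union>{C. (t, C) \<in> I}) \<in> Ls"
      using insert p by (intro language_family_Un cls) auto
    also have "(\<lambda>t. single s C t \<union> \<Union>{C. (t, C) \<in> I}) = (\<lambda>t. \<Union>{C. (t, C) \<in> insert p I})"
      by (auto simp: p single_def fun_eq_iff)
    finally show ?case .
  qed
  let ?I = "SIGMA s:S. {C \<in> car \<A> s // \<Phi> s. C \<subseteq> K s}"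
  have "finite (SIGMA s:S. car \<A> s // \<Phi> s)"
    using assms(2) by (simp add: finite_index_def sorted_finite_def quotient_alg_def)
  then have "(\<lambda>t. \<Union>{C. (t, C) \<in> ?I}) \<in> Ls"
    by (intro un) (auto elim: finite_subset[rotated])
  also have "(\<lambda>t. \<Union>{C. (t, C) \<in> ?I}) = K"
  proof
    fix t
    show "\<Union>{C. (t, C) \<in> ?I} = K t"
    proof (cases "t \<in> S")
      case True
      with K obtain X where "X \<subseteq> car \<A> t // \<Phi> t" "K t = \<Union>X" by (auto simp: Sat_def)
      with True show ?thesis by auto
    next
      case False
      with K show ?thesis by (simp add: Sat_def)
    qed
  qed
  finally show "K \<in> Ls" .
qed

text \<open>The greatest congruence makes the set nonempty. A class of an intersection is an
  intersection of two classes, so \<open>language_family_Int\<close> handles binary meets; a coarser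
  congruence keeps finite index and has no new saturated languages.\<close>

lemma fi_filter_congruences: "fi_filter S Sg \<A> (congruences S Sg \<A> Ls)"
  unfolding fi_filter_def cgr_filter_def
proof (intro conjI ballI impI)
  show "congruences S Sg \<A> Ls \<subseteq> Cgr S Sg \<A>"
    by (auto simp: congruences_def)
  have "nabla S Sg \<A> \<in> congruences S Sg \<A> Ls"
    using Ls nabla_congruence nabla_finite_index
    by (auto simp: congruences_def Cgr_def language_family_def)
  then show "congruences S Sg \<A> Ls \<noteq> {}" by blast
next
  fix \<Phi> \<Psi> assume P: "\<Phi> \<in> congruences S Sg \<A> Ls" "\<Psi> \<in> congruences S Sg \<A> Ls"
  then have c: "congruence S Sg \<A> \<Phi>" "congruence S Sg \<A> \<Psi>"
    and f: "finite_index S \<A> \<Phi>" "finite_index S \<A> \<Psi>"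
    and L: "Sat S \<A> \<Phi> \<subseteq> Ls" "Sat S \<A> \<Psi> \<subseteq> Ls"
    by (auto simp: congruences_def Cgr_def)
  have "Sat S \<A> (\<lambda>s. \<Phi> s \<inter> \<Psi> s) \<subseteq> Ls"
  proof (rule Sat_subset_language_family)
    fix s X assume s: "s \<in> S" and "X \<in> car \<A> s // (\<Phi> s \<inter> \<Psi> s)"
    then obtain x where x: "x \<in> car \<A> s" "X = (\<Phi> s \<inter> \<Psi> s) `` {x}" by (auto elim: quotientE)
    have "single s (\<Phi> s `` {x}) \<in> Ls" "single s (\<Psi> s `` {x}) \<in> Ls"
      using L single_class_saturated[OF _ s quotientI[OF x(1)]] c by blast+
    then have "(\<lambda>t. single s (\<Phi> s `` {x}) t \<inter> single s (\<Psi> s `` {x}) t) \<in> Ls"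
      by (rule language_family_Int)
    also have "(\<lambda>t. single s (\<Phi> s `` {x}) t \<inter> single s (\<Psi> s `` {x}) t) = single s X"
      by (auto simp: x single_def fun_eq_iff)
    finally show "single s X \<in> Ls" .
  qed (intro congruence_Int finite_index_Int finite_S c f)+
  then show "(\<lambda>s. \<Phi> s \<inter> \<Psi> s) \<in> congruences S Sg \<A> Ls"
    using congruence_Int[OF c] finite_index_Int[OF finite_S f] by (simp add: congruences_def Cgr_def)
next
  fix \<Phi> \<Psi> assume "\<Phi> \<in> congruences S Sg \<A> Ls" "\<Psi> \<in> Cgr S Sg \<A>" "\<Phi> \<le> \<Psi>"
  then show "\<Psi> \<in> congruences S Sg \<A> Ls"
    using Sat_antimono finite_index_mono[OF finite_S] unfolding congruences_def Cgr_def by blast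
qed (auto simp: congruences_def)

text \<open>For \<open>L\<close> in \<open>Ls\<close> the witness is its own syntactic
  congruence.\<close>

lemma languages_congruences: "languages S \<A> (congruences S Sg \<A> Ls) = Ls"
proof
  show "languages S \<A> (congruences S Sg \<A> Ls) \<subseteq> Ls"
    by (auto simp: languages_def congruences_def)
  show "Ls \<subseteq> languages S \<A> (congruences S Sg \<A> Ls)"
  proof
    fix L assume L: "L \<in> Ls"
    note sorted = language_family_sorted[OF L]
    \<comment> \<open>Condition (2) with both languages equal to \<open>L\<close>, the intersection
      being \<open>Omega\<close> of \<open>L\<close> itself.\<close>
    have "Sat S \<A> (Omega S Sg \<A> L) \<subseteq> Ls"
      using Ls L unfolding language_family_def by fastforce
    moreover have "finite_index S \<A> (Omega S Sg \<A> L)"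
      using Ls L by (auto simp: language_family_def Lang_r_def)
    ultimately show "L \<in> languages S \<A> (congruences S Sg \<A> Ls)"
      using Omega_congruence[OF sorted] Omega_saturates[OF sorted]
      by (auto simp: languages_def congruences_def Cgr_def)
  qed
qed

end

section \<open>From filters of congruences to families of languages\<close>

context
  fixes F assumes F: "fi_filter S Sg \<A> F"
begin

lemma fi_filter_congruence: "\<Phi> \<in> F \<Longrightarrow> congruence S Sg \<A> \<Phi>"
  using F by (auto simp: fi_filter_def cgr_filter_def Cgr_def)

lemma fi_filter_finite_index: "\<Phi> \<in> F \<Longrightarrow> finite_index S \<A> \<Phi>"
  using F by (simp add: fi_filter_def)

lemma fi_filter_Int: "\<Phi> \<in> F \<Longrightarrow> \<Psi> \<in> F \<Longrightarrow> (\<lambda>s. \<Phi> s \<inter> \<Psi> s) \<in> F"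
  using F by (simp add: fi_filter_def cgr_filter_def)

lemma fi_filter_upward: "\<Phi> \<in> F \<Longrightarrow> congruence S Sg \<A> \<Psi> \<Longrightarrow> \<Phi> \<le> \<Psi> \<Longrightarrow> \<Psi> \<in> F"
  using F unfolding fi_filter_def cgr_filter_def Cgr_def by blast

lemma fi_filter_nabla: "nabla S Sg \<A> \<in> F"
proof -
  obtain \<Phi> where "\<Phi> \<in> F" using F by (auto simp: fi_filter_def cgr_filter_def)
  then show ?thesis
    using fi_filter_upward nabla_congruence nabla_greatest fi_filter_congruence by blast
qed

text \<open>Any member of \<open>F\<close> saturating \<open>L\<close> lies below
  \<open>Omega\<close> of \<open>L\<close>, which upward closure then puts into \<open>F\<close>; so
  a single congruence decides membership.\<close>

lemma languages_iff:
  "L \<in> languages S \<A> F \<longleftrightarrow> sorted_subset S (car \<A>) L \<and> Omega S Sg \<A> L \<in> F"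
proof
  assume "L \<in> languages S \<A> F"
  then obtain \<Phi> where \<Phi>: "\<Phi> \<in> F" "L \<in> Sat S \<A> \<Phi>" by (auto simp: languages_def)
  have c: "congruence S Sg \<A> \<Phi>" using \<Phi>(1) by (rule fi_filter_congruence)
  note sorted = SatD(1)[OF c \<Phi>(2)]
  show "sorted_subset S (car \<A>) L \<and> Omega S Sg \<A> L \<in> F"
    using sorted fi_filter_upward[OF \<Phi>(1) Omega_congruence[OF sorted] Omega_greatest[OF c \<Phi>(2)]]
    by blast
next
  assume "sorted_subset S (car \<A>) L \<and> Omega S Sg \<A> L \<in> F"
  then show "L \<in> languages S \<A> F"
    using Omega_saturates by (auto simp: languages_def)
qed

lemma language_family_languages: "language_family S Sg \<A> (languages S \<A> F)"
proof -
  have "languages S \<A> F \<subseteq> Lang_r S Sg \<A>"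
    using fi_filter_finite_index by (fastforce simp: languages_iff Lang_r_def sorted_subset_def)
  moreover have "Sat S \<A> (nabla S Sg \<A>) \<subseteq> languages S \<A> F"
    using fi_filter_nabla by (auto simp: languages_def)
  moreover have "Sat S \<A> (\<lambda>s. Omega S Sg \<A> L s \<inter> Omega S Sg \<A> L' s) \<subseteq> languages S \<A> F"
    if "L \<in> languages S \<A> F" "L' \<in> languages S \<A> F" for L L'
  proof -
    have "(\<lambda>s. Omega S Sg \<A> L s \<inter> Omega S Sg \<A> L' s) \<in> F"
      using that by (intro fi_filter_Int) (auto simp: languages_iff)
    then show ?thesis unfolding languages_def by (rule UN_upper)
  qed
  ultimately show ?thesis by (simp add: language_family_def)
qed

text \<open>In the harder inclusion, each class of \<Phi> is a \<Phi>-saturated language, so by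
  \<open>languages_iff\<close> its syntactic congruence is in \<open>F\<close>. There are finitely
  many classes, and the intersection of these congruences lies below \<Phi>.\<close>

lemma congruences_languages: "congruences S Sg \<A> (languages S \<A> F) = F"
proof
  show "F \<subseteq> congruences S Sg \<A> (languages S \<A> F)"
    using fi_filter_congruence fi_filter_finite_index
    by (auto simp: congruences_def Cgr_def languages_def)
  show "congruences S Sg \<A> (languages S \<A> F) \<subseteq> F"
  proof
    fix \<Phi> assume "\<Phi> \<in> congruences S Sg \<A> (languages S \<A> F)"
    then have c: "congruence S Sg \<A> \<Phi>" and fi: "finite_index S \<A> \<Phi>"
      and L: "Sat S \<A> \<Phi> \<subseteq> languages S \<A> F" by (auto simp: congruences_def Cgr_def)
    let ?\<Omega> = "\<lambda>p. Omega S Sg \<A> (single (fst p) (snd p))"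
    \<comment> \<open>\<open>nabla\<close> is the value for empty \<open>I\<close>: a bare
      intersection over the empty set would be the universal relation on the type. It also keeps the
      pairs inside the carriers.\<close>
    have inter: "(\<lambda>t. nabla S Sg \<A> t \<inter> (\<Inter>p\<in>I. ?\<Omega> p t)) \<in> F"
      if "finite I" "I \<subseteq> (SIGMA s:S. car \<A> s // \<Phi> s)" for I
      using that
    proof (induction I)
      case empty
      then show ?case using fi_filter_nabla by simp
    next
      case (insert p I)
      then have "single (fst p) (snd p) \<in> Sat S \<A> \<Phi>"
        using single_class_saturated[OF c] by auto
      with L have "?\<Omega> p \<in> F" using languages_iff by blast
      moreover have "(\<lambda>t. nabla S Sg \<A> t \<inter> (\<Inter>p\<in>I. ?\<Omega> p t)) \<in> F"
        using insert by blast
      ultimately have "(\<lambda>t. ?\<Omega> p t \<inter> (nabla S Sg \<A> t \<inter> (\<Inter>p\<in>I. ?\<Omega> p t))) \<in> F"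
        by (rule fi_filter_Int)
      also have "(\<lambda>t. ?\<Omega> p t \<inter> (nabla S Sg \<A> t \<inter> (\<Inter>p\<in>I. ?\<Omega> p t)))
          = (\<lambda>t. nabla S Sg \<A> t \<inter> (\<Inter>p\<in>insert p I. ?\<Omega> p t))"
        by auto
      finally show ?case .
    qed
    let ?I = "SIGMA s:S. car \<A> s // \<Phi> s"
    have "finite ?I"
      using fi by (simp add: finite_index_def sorted_finite_def quotient_alg_def)
    then have "(\<lambda>t. nabla S Sg \<A> t \<inter> (\<Inter>p\<in>?I. ?\<Omega> p t)) \<in> F" by (rule inter) simp
    moreover have "(\<lambda>t. nabla S Sg \<A> t \<inter> (\<Inter>p\<in>?I. ?\<Omega> p t)) \<le> \<Phi>"
    proof (rule le_funI, rule subsetI)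
      fix t q assume q: "q \<in> nabla S Sg \<A> t \<inter> (\<Inter>p\<in>?I. ?\<Omega> p t)"
      then obtain x y where xy: "q = (x, y)" and t: "t \<in> S" and x: "x \<in> car \<A> t"
        by (auto simp: nabla_eq split: if_splits)
      \<comment> \<open>The class of \<open>x\<close> as a language separates \<open>x\<close> from
        everything outside it, so its syntactic congruence forces \<open>y\<close> into that
        class.\<close>
      let ?C = "\<Phi> t `` {x}"
      have C: "?C \<in> car \<A> t // \<Phi> t" using x by (rule quotientI)
      have sorted: "sorted_subset S (car \<A>) (single t ?C)"
        using SatD(1)[OF c single_class_saturated[OF c t C]] .
      have "(x, y) \<in> Omega S Sg \<A> (single t ?C) t" using q xy t C by fastforce
      moreover have "x \<in> single t ?C t"
        using equiv_class_self[OF congruence_equiv[OF c t] x] by (simp add: single_def)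
      ultimately have "y \<in> single t ?C t"
        using Omega_closed sorted t by blast
      then show "q \<in> \<Phi> t" by (simp add: xy single_def)
    qed
    ultimately show "\<Phi> \<in> F" using c fi_filter_upward by blast
  qed
qed

end

end

section \<open>Homomorphisms into a quotient\<close>

lemma listset_iff: "ys \<in> listset Xs \<longleftrightarrow> list_all2 (\<in>) ys Xs"
proof (induction Xs arbitrary: ys)
  case (Cons X Xs)
  then show ?case by (auto simp: set_Cons_def list_all2_Cons2)
qed simp

lemma homs_closed: "f \<in> homs S Sg \<A> \<B> \<Longrightarrow> s \<in> S \<Longrightarrow> x \<in> car \<A> s \<Longrightarrow> f s x \<in> car \<B> s"
  by (auto simp: homs_def)

lemma homs_word_prod:
  assumes "f \<in> homs S Sg \<A> \<B>" "w \<in> lists S" "xs \<in> word_prod (car \<A>) w"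
  shows "map2 f w xs \<in> word_prod (car \<B>) w"
proof -
  have "w ! i \<in> S" if "i < length w" for i
    using assms(2) that by (simp add: lists_eq_set subset_iff)
  then show ?thesis
    using homs_closed[OF assms(1)] word_prodD[OF assms(3)]
    by (auto simp: word_prod_def list_all2_conv_all_nth)
qed

text \<open>All lists of representatives give related results by compatibility, so the union in
  \<open>quotient_alg\<close> is taken over a constant family; it is nonempty because
  \<open>zs\<close> is one such list.\<close>

lemma quotient_opn:
  assumes "congruence S Sg \<B> \<Theta>" "w \<in> lists S" "s \<in> S" "\<sigma> \<in> Sg w s" "zs \<in> word_prod (car \<B>) w"
  shows "opn (quotient_alg \<B> \<Theta>) w s \<sigma> (map2 (pr \<Theta>) w zs) = pr \<Theta> s (opn \<B> w s \<sigma> zs)"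
proof -
  have S: "w ! i \<in> S" if "i < length w" for i
    using assms(2) that by (simp add: lists_eq_set subset_iff)
  have eq: "equiv (car \<B> (w ! i)) (\<Theta> (w ! i))" if "i < length w" for i
    using congruence_equiv[OF assms(1) S[OF that]] .
  have "\<Theta> s `` {opn \<B> w s \<sigma> ys} = \<Theta> s `` {opn \<B> w s \<sigma> zs}"
    if "ys \<in> listset (map2 (pr \<Theta>) w zs)" for ys
  proof -
    have len: "length ys = length w" and rel: "\<forall>i<length w. (zs ! i, ys ! i) \<in> \<Theta> (w ! i)"
      using that word_prodD(1)[OF assms(5)]
      by (auto simp: listset_iff list_all2_conv_all_nth pr_def)
    have "ys \<in> word_prod (car \<B>) w"
      using len rel equiv_class_eq_iff[OF eq] by (auto simp: word_prod_def list_all2_conv_all_nth)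
    then have "(opn \<B> w s \<sigma> zs, opn \<B> w s \<sigma> ys) \<in> \<Theta> s"
      using assms rel unfolding congruence_def by blast
    then show ?thesis
      using equiv_class_eq[OF congruence_equiv[OF assms(1,3)]] by blast
  qed
  moreover have "zs \<in> listset (map2 (pr \<Theta>) w zs)"
    using word_prodD[OF assms(5)] equiv_class_self[OF eq]
    by (auto simp: listset_iff list_all2_conv_all_nth pr_def)
  ultimately have "(\<Union>ys\<in>listset (map2 (pr \<Theta>) w zs). \<Theta> s `` {opn \<B> w s \<sigma> ys}) = \<Theta> s `` {opn \<B> w s \<sigma> zs}"
    by (intro SUP_eq_const) blast+
  then show ?thesis
    by (simp only: quotient_alg_def algebra.select_convs pr_def[of \<Theta> s "opn \<B> w s \<sigma> zs"])
qed

lemma pr_in_quotient: "x \<in> car \<B> s \<Longrightarrow> pr \<Theta> s x \<in> car (quotient_alg \<B> \<Theta>) s"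
  by (simp add: pr_def quotient_alg_def quotientI)

lemma pr_eq_iff:
  assumes "congruence S Sg \<B> \<Theta>" "s \<in> S" "x \<in> car \<B> s" "y \<in> car \<B> s"
  shows "pr \<Theta> s x = pr \<Theta> s y \<longleftrightarrow> (x, y) \<in> \<Theta> s"
  using assms unfolding pr_def by (intro eq_equiv_class_iff[OF congruence_equiv])

lemma pr_comp_homs:
  assumes "congruence S Sg \<B> \<Theta>" "f \<in> homs S Sg \<A> \<B>"
  shows "(\<lambda>s. pr \<Theta> s \<circ> f s) \<in> homs S Sg \<A> (quotient_alg \<B> \<Theta>)"
proof -
  have "(pr \<Theta> s \<circ> f s) (opn \<A> w s \<sigma> xs) = opn (quotient_alg \<B> \<Theta>) w s \<sigma> (map2 (\<lambda>s. pr \<Theta> s \<circ> f s) w xs)"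
    if *: "w \<in> lists S" "s \<in> S" "\<sigma> \<in> Sg w s" "xs \<in> word_prod (car \<A>) w" for w s \<sigma> xs
  proof -
    have "map2 (\<lambda>s. pr \<Theta> s \<circ> f s) w xs = map2 (pr \<Theta>) w (map2 f w xs)"
      using word_prodD(1)[OF *(4)] by (auto intro: nth_equalityI)
    then show ?thesis
      using quotient_opn[OF assms(1) *(1-3) homs_word_prod[OF assms(2) *(1,4)]] assms(2) *
      by (simp add: homs_def)
  qed
  moreover have "pr \<Theta> s \<circ> f s \<in> car \<A> s \<rightarrow> car (quotient_alg \<B> \<Theta>) s" if "s \<in> S" for s
    using homs_closed[OF assms(2) that] by (simp add: Pi_iff pr_in_quotient)
  ultimately show ?thesis
    unfolding homs_def by blast
qed

text \<open>Stated with elements instead of classes, the condition visibly survives enlarging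
  \<Theta>; the homomorphism half of \<open>epi\<close> always holds by
  \<open>pr_comp_homs\<close>.\<close>

lemma epi_pr_iff:
  assumes "congruence S Sg \<B> \<Theta>" "f \<in> homs S Sg \<A> \<B>"
  shows "epi S Sg \<A> (quotient_alg \<B> \<Theta>) (\<lambda>s. pr \<Theta> s \<circ> f s) \<longleftrightarrow>
    (\<forall>s\<in>S. \<forall>b\<in>car \<B> s. \<exists>a\<in>car \<A> s. (f s a, b) \<in> \<Theta> s)"
proof -
  have "(pr \<Theta> s \<circ> f s) ` car \<A> s = car (quotient_alg \<B> \<Theta>) s \<longleftrightarrow>
      (\<forall>b\<in>car \<B> s. \<exists>a\<in>car \<A> s. (f s a, b) \<in> \<Theta> s)" if s: "s \<in> S" for s
  proof -
    have "car (quotient_alg \<B> \<Theta>) s = pr \<Theta> s ` car \<B> s"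
      by (auto simp: quotient_alg_def pr_def quotient_def)
    moreover have "(pr \<Theta> s \<circ> f s) ` car \<A> s \<subseteq> pr \<Theta> s ` car \<B> s"
      using homs_closed[OF assms(2) s] by auto
    ultimately have "(pr \<Theta> s \<circ> f s) ` car \<A> s = car (quotient_alg \<B> \<Theta>) s \<longleftrightarrow>
        pr \<Theta> s ` car \<B> s \<subseteq> (pr \<Theta> s \<circ> f s) ` car \<A> s"
      by (metis subset_antisym order_refl)
    also have "\<dots> \<longleftrightarrow> (\<forall>b\<in>car \<B> s. \<exists>a\<in>car \<A> s. pr \<Theta> s (f s a) = pr \<Theta> s b)"
      unfolding image_subset_iff image_iff comp_apply by (simp only: eq_commute)
    also have "\<dots> \<longleftrightarrow> (\<forall>b\<in>car \<B> s. \<exists>a\<in>car \<A> s. (f s a, b) \<in> \<Theta> s)"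
      using pr_eq_iff[OF assms(1) s homs_closed[OF assms(2) s]] by simp
    finally show ?thesis .
  qed
  then show ?thesis
    using pr_comp_homs[OF assms] by (simp add: epi_def)
qed

lemma Ker_pr_iff:
  assumes "congruence S Sg \<B> \<Theta>" "f \<in> homs S Sg \<A> \<B>"
  shows "(x, y) \<in> Ker S \<A> (\<lambda>s. pr \<Theta> s \<circ> f s) s \<longleftrightarrow>
    s \<in> S \<and> x \<in> car \<A> s \<and> y \<in> car \<A> s \<and> (f s x, f s y) \<in> \<Theta> s"
  by (simp add: Ker_def pr_eq_iff[OF assms(1)] homs_closed[OF assms(2)] cong: conj_cong)

lemma (in sorted_algebra) Ker_congruence:
  assumes "f \<in> homs S Sg \<A> \<B>"
  shows "congruence S Sg \<A> (Ker S \<A> f)"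
proof -
  have "(opn \<A> w s \<sigma> xs, opn \<A> w s \<sigma> ys) \<in> Ker S \<A> f s"
    if *: "w \<in> lists S" "s \<in> S" "\<sigma> \<in> Sg w s" "xs \<in> word_prod (car \<A>) w" "ys \<in> word_prod (car \<A>) w"
      "\<forall>i<length w. (xs ! i, ys ! i) \<in> Ker S \<A> f (w ! i)" for w s \<sigma> xs ys
  proof -
    have "map2 f w xs = map2 f w ys"
      using word_prodD(1)[OF *(4)] word_prodD(1)[OF *(5)] *(6)
      by (auto simp: Ker_def intro: nth_equalityI)
    then show ?thesis using assms * opn_closed by (simp add: homs_def Ker_def)
  qed
  moreover have "equiv (car \<A> s) (Ker S \<A> f s)" if "s \<in> S" for s
    using that by (auto intro!: equivI simp: Ker_def refl_on_def sym_def trans_def)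
  moreover have "Ker S \<A> f s = {}" if "s \<notin> S" for s
    using that by (simp add: Ker_def)
  ultimately show ?thesis
    unfolding congruence_def by blast
qed

lemma quotient_Ker:
  assumes "s \<in> S" "X \<in> car \<A> s // Ker S \<A> f s"
  obtains x where "x \<in> car \<A> s" "X = {y \<in> car \<A> s. f s y = f s x}"
  using assms(2)
proof (rule quotientE)
  fix x assume "X = Ker S \<A> f s `` {x}" "x \<in> car \<A> s"
  then show thesis using assms(1) by (intro that[of x]) (auto simp: Ker_def)
qed

text \<open>A kernel class is the fibre of \<open>f\<close> over a \<Theta>-class, so in each sort
  there are no more kernel classes than \<Theta>-classes.\<close>

lemma Ker_finite_index:
  assumes "finite S" "finite_index S \<B> \<Theta>" "f \<in> homs S Sg \<A> (quotient_alg \<B> \<Theta>)"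
  shows "finite_index S \<A> (Ker S \<A> f)"
  unfolding finite_index_iff[OF assms(1)]
proof
  fix s assume s: "s \<in> S"
  have "car \<A> s // Ker S \<A> f s \<subseteq> (\<lambda>D. {y \<in> car \<A> s. f s y = D}) ` (car \<B> s // \<Theta> s)"
  proof
    fix X assume "X \<in> car \<A> s // Ker S \<A> f s"
    then obtain x where "x \<in> car \<A> s" "X = {y \<in> car \<A> s. f s y = f s x}"
      using quotient_Ker[OF s] by blast
    then show "X \<in> (\<lambda>D. {y \<in> car \<A> s. f s y = D}) ` (car \<B> s // \<Theta> s)"
      using homs_closed[OF assms(3) s] by (auto simp: quotient_alg_def)
  qed
  then show "finite (car \<A> s // Ker S \<A> f s)"
    using assms(2) s by (auto simp: finite_index_iff[OF assms(1)] intro: finite_subset)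
qed


section \<open>Formations\<close>

lemma sorted_algebra_free_alg: "sorted_algebra S Sg (free_alg S Sg A)"
  by unfold_locales (auto simp: free_alg_def word_prod_def intro: well_sorted.App)

lemma finite_sorted_algebra_free_alg: "finite S \<Longrightarrow> finite_sorted_algebra S Sg (free_alg S Sg A)"
  by (simp add: finite_sorted_algebra_def finite_sorted_algebra_axioms_def sorted_algebra_free_alg)

text \<open>Regroups the conditions so that those about a single algebra form
  \<open>fi_filter\<close>, to which the results on one algebra apply.\<close>

lemma formation_cgr_fi_iff:
  "formation_cgr_fi U S Sg \<FF> \<longleftrightarrow>
     \<FF> \<in> extensional (sorted_sets U S) \<and>
     (\<forall>A\<in>sorted_sets U S. fi_filter S Sg (free_alg S Sg A) (\<FF> A)) \<and>
     (\<forall>A\<in>sorted_sets U S. \<forall>B\<in>sorted_sets U S. \<forall>\<Theta>\<in>\<FF> B.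
        \<forall>f\<in>homs S Sg (free_alg S Sg A) (free_alg S Sg B).
        epi S Sg (free_alg S Sg A) (quotient_alg (free_alg S Sg B) \<Theta>) (\<lambda>s. pr \<Theta> s \<circ> f s) \<longrightarrow>
        Ker S (free_alg S Sg A) (\<lambda>s. pr \<Theta> s \<circ> f s) \<in> \<FF> A)"
  unfolding formation_cgr_fi_def fi_filter_def by blast

lemma formation_lang_r_iff:
  "formation_lang_r U S Sg \<L> \<longleftrightarrow>
     \<L> \<in> extensional (sorted_sets U S) \<and>
     (\<forall>A\<in>sorted_sets U S. language_family S Sg (free_alg S Sg A) (\<L> A)) \<and>
     (\<forall>A\<in>sorted_sets U S. \<forall>B\<in>sorted_sets U S. \<forall>M\<in>\<L> B.
        \<forall>f\<in>homs S Sg (free_alg S Sg A) (free_alg S Sg B).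
        (let \<Theta> = Omega S Sg (free_alg S Sg B) M; g = (\<lambda>s. pr \<Theta> s \<circ> f s) in
          epi S Sg (free_alg S Sg A) (quotient_alg (free_alg S Sg B) \<Theta>) g \<longrightarrow>
          Sat S (free_alg S Sg A) (Ker S (free_alg S Sg A) g) \<subseteq> \<L> A))"
  unfolding formation_lang_r_def language_family_def by blast

section \<open>The two mutually inverse maps between formations\<close>

definition languages_of where
  "languages_of U S Sg \<FF> = (\<lambda>A\<in>sorted_sets U S. languages S (free_alg S Sg A) (\<FF> A))"

definition congruences_of where
  "congruences_of U S Sg \<L> = (\<lambda>A\<in>sorted_sets U S. congruences S Sg (free_alg S Sg A) (\<L> A))"

context
  fixes U :: "'x set set" and S :: "'s set" and Sg :: "'s list \<Rightarrow> 's \<Rightarrow> 'f set"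
  assumes S: "finite S"
begin

interpretation T: finite_sorted_algebra S Sg "free_alg S Sg A" for A :: "'s \<Rightarrow> 'x set"
  using S by (rule finite_sorted_algebra_free_alg)

text \<open>By \<open>languages_iff\<close> the syntactic congruence of \<open>M\<close> belongs to
  the filter at \<open>B\<close>, so the condition on homomorphisms puts the kernel into the filter
  at \<open>A\<close>, and with it all languages saturated by that kernel into the image.\<close>

lemma languages_of_formation:
  assumes F: "formation_cgr_fi U S Sg \<FF>"
  shows "formation_lang_r U S Sg (languages_of U S Sg \<FF>)"
  unfolding formation_lang_r_iff
proof (intro conjI ballI)
  show "languages_of U S Sg \<FF> \<in> extensional (sorted_sets U S)"
    by (simp add: languages_of_def)
  show "language_family S Sg (free_alg S Sg A) (languages_of U S Sg \<FF> A)"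
    if "A \<in> sorted_sets U S" for A
    using that F T.language_family_languages by (simp add: languages_of_def formation_cgr_fi_iff)
next
  fix A B M f
  assume A: "A \<in> sorted_sets U S" and B: "B \<in> sorted_sets U S"
    and M: "M \<in> languages_of U S Sg \<FF> B" and f: "f \<in> homs S Sg (free_alg S Sg A) (free_alg S Sg B)"
  have "Omega S Sg (free_alg S Sg B) M \<in> \<FF> B"
    using B M F T.languages_iff by (simp add: languages_of_def formation_cgr_fi_iff)
  then have "epi S Sg (free_alg S Sg A) (quotient_alg (free_alg S Sg B) (Omega S Sg (free_alg S Sg B) M))
      (\<lambda>s. pr (Omega S Sg (free_alg S Sg B) M) s \<circ> f s) \<Longrightarrow>
    Ker S (free_alg S Sg A) (\<lambda>s. pr (Omega S Sg (free_alg S Sg B) M) s \<circ> f s) \<in> \<FF> A"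
    using A B f F unfolding formation_cgr_fi_iff by blast
  then show "let \<Theta> = Omega S Sg (free_alg S Sg B) M; g = (\<lambda>s. pr \<Theta> s \<circ> f s) in
      epi S Sg (free_alg S Sg A) (quotient_alg (free_alg S Sg B) \<Theta>) g \<longrightarrow>
      Sat S (free_alg S Sg A) (Ker S (free_alg S Sg A) g) \<subseteq> languages_of U S Sg \<FF> A"
    unfolding Let_def using A by (auto simp: languages_of_def languages_def)
qed

text \<open>\<Theta> need not be the syntactic congruence of one language, so the kernel is treated
  class by class. A kernel class is the preimage of a \<Theta>-class; the hypothesis applies to the
  syntactic congruence of that \<Theta>-class, and the preimage is saturated for the resulting
  kernel.\<close>

lemma congruences_of_formation:
  assumes L: "formation_lang_r U S Sg \<L>"
  shows "formation_cgr_fi U S Sg (congruences_of U S Sg \<L>)"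
  unfolding formation_cgr_fi_iff
proof (intro conjI ballI impI)
  show "congruences_of U S Sg \<L> \<in> extensional (sorted_sets U S)"
    by (simp add: congruences_of_def)
  show "fi_filter S Sg (free_alg S Sg A) (congruences_of U S Sg \<L> A)"
    if "A \<in> sorted_sets U S" for A
    using that L T.fi_filter_congruences by (simp add: congruences_of_def formation_lang_r_iff)
next
  fix A B :: "'s \<Rightarrow> 'x set" and \<Theta> f
  let ?A = "free_alg S Sg A" and ?B = "free_alg S Sg B"
  assume A: "A \<in> sorted_sets U S" and B: "B \<in> sorted_sets U S"
    and \<Theta>: "\<Theta> \<in> congruences_of U S Sg \<L> B" and f: "f \<in> homs S Sg ?A ?B"
    and epi: "epi S Sg ?A (quotient_alg ?B \<Theta>) (\<lambda>s. pr \<Theta> s \<circ> f s)"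
  have c: "congruence S Sg ?B \<Theta>" and fi: "finite_index S ?B \<Theta>" and sat: "Sat S ?B \<Theta> \<subseteq> \<L> B"
    using \<Theta> B by (auto simp: congruences_of_def congruences_def Cgr_def)
  let ?K = "Ker S ?A (\<lambda>s. pr \<Theta> s \<circ> f s)"
  note hom = pr_comp_homs[OF c f]
  have family: "language_family S Sg ?A (\<L> A)" using L A by (simp add: formation_lang_r_iff)
  have "Sat S ?A ?K \<subseteq> \<L> A"
  proof (rule T.Sat_subset_language_family[OF family T.Ker_congruence[OF hom] Ker_finite_index[OF S fi hom]])
    fix s X assume s: "s \<in> S" and cls: "X \<in> car ?A s // ?K s"
    obtain x where x: "x \<in> car ?A s" and X: "X = {y \<in> car ?A s. pr \<Theta> s (f s y) = pr \<Theta> s (f s x)}"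
      by (rule quotient_Ker[OF s cls]) (simp only: comp_apply)
    \<comment> \<open>The \<Theta>-class of \<open>f s x\<close>, whose preimage is
      \<open>X\<close>.\<close>
    let ?M = "single s (pr \<Theta> s (f s x))"
    have M: "?M \<in> Sat S ?B \<Theta>"
      using single_class_saturated[OF c s] homs_closed[OF f s x] by (simp add: pr_def quotientI)
    note sorted = SatD(1)[OF c M]
    let ?\<Omega> = "Omega S Sg ?B ?M"
    note \<Omega> = T.Omega_congruence[OF sorted]
    \<comment> \<open>Passing to a coarser congruence keeps the composite with the projection
      surjective.\<close>
    have "\<Theta> \<le> ?\<Omega>" by (rule T.Omega_greatest[OF c M])
    then have "epi S Sg ?A (quotient_alg ?B ?\<Omega>) (\<lambda>s. pr ?\<Omega> s \<circ> f s)"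
      using epi unfolding epi_pr_iff[OF c f] epi_pr_iff[OF \<Omega> f] le_fun_def by blast
    then have "Sat S ?A (Ker S ?A (\<lambda>s. pr ?\<Omega> s \<circ> f s)) \<subseteq> \<L> A"
      using L A B f M sat unfolding formation_lang_r_iff Let_def by blast
    moreover have "single s X \<in> Sat S ?A (Ker S ?A (\<lambda>s. pr ?\<Omega> s \<circ> f s))"
    proof (rule SatI[OF T.Ker_congruence[OF pr_comp_homs[OF \<Omega> f]]])
      show "sorted_subset S (car ?A) (single s X)"
        using s X by (auto simp: sorted_subset_def single_def)
    next
      fix t y z assume yz: "(y, z) \<in> Ker S ?A (\<lambda>s. pr ?\<Omega> s \<circ> f s) t" and y: "y \<in> single s X t"
      then have t: "t = s" by (auto simp: single_def split: if_splits)
      have rel: "(f s y, f s z) \<in> ?\<Omega> s" and yA: "y \<in> car ?A s" and zA: "z \<in> car ?A s"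
        using yz unfolding t Ker_pr_iff[OF \<Omega> f] by auto
      \<comment> \<open>\<open>X\<close> is the preimage of \<open>?M\<close>, so closure of
        \<open>?M\<close> under its syntactic congruence pulls back to closure of \<open>X\<close>
        under the kernel.\<close>
      have mem_X: "u \<in> X \<longleftrightarrow> f s u \<in> ?M s" if u: "u \<in> car ?A s" for u
      proof -
        have "u \<in> X \<longleftrightarrow> pr \<Theta> s (f s x) = pr \<Theta> s (f s u)"
          using u unfolding X by (simp add: eq_commute)
        also have "\<dots> \<longleftrightarrow> f s u \<in> ?M s"
          using pr_eq_iff[OF c s homs_closed[OF f s x] homs_closed[OF f s u]]
          by (simp add: single_def pr_def)
        finally show ?thesis .
      qed
      have "y \<in> X" using y t by (simp add: single_def)
      then have "f s z \<in> ?M s"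
        using T.Omega_closed[OF sorted s rel] mem_X yA by blast
      then show "z \<in> single s X t" using mem_X zA t by (simp add: single_def)
    qed
    ultimately show "single s X \<in> \<L> A" by blast
  qed
  then show "?K \<in> congruences_of U S Sg \<L> A"
    using A T.Ker_congruence[OF hom] Ker_finite_index[OF S fi hom]
    by (simp add: congruences_of_def congruences_def Cgr_def)
qed

lemma congruences_of_languages_of:
  assumes "formation_cgr_fi U S Sg \<FF>"
  shows "congruences_of U S Sg (languages_of U S Sg \<FF>) = \<FF>"
proof (rule extensionalityI)
  show "\<FF> \<in> extensional (sorted_sets U S)" using assms by (simp add: formation_cgr_fi_iff)
qed (use assms T.congruences_languages in
    \<open>auto simp: congruences_of_def languages_of_def formation_cgr_fi_iff\<close>)

lemma languages_of_congruences_of: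
  assumes "formation_lang_r U S Sg \<L>"
  shows "languages_of U S Sg (congruences_of U S Sg \<L>) = \<L>"
proof (rule extensionalityI)
  show "\<L> \<in> extensional (sorted_sets U S)" using assms by (simp add: formation_lang_r_iff)
qed (use assms T.languages_congruences in
    \<open>auto simp: congruences_of_def languages_of_def formation_lang_r_iff\<close>)

lemma lattice_isomorphic_formations:
  "lattice_isomorphic (Form_Cgr_fi U S Sg) (Form_Lang_r U S Sg)"
  unfolding lattice_isomorphic_def
proof (intro exI conjI ballI)
  show "bij_betw (languages_of U S Sg) (carrier (Form_Cgr_fi U S Sg)) (carrier (Form_Lang_r U S Sg))"
    by (rule bij_betwI[where g = "congruences_of U S Sg"])
      (auto simp: Form_Cgr_fi_def Form_Lang_r_def languages_of_formation congruences_of_formation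
        congruences_of_languages_of languages_of_congruences_of)
next
  fix \<FF> \<GG>
  assume "\<FF> \<in> carrier (Form_Cgr_fi U S Sg)" "\<GG> \<in> carrier (Form_Cgr_fi U S Sg)"
  then have F: "formation_cgr_fi U S Sg \<FF>" and G: "formation_cgr_fi U S Sg \<GG>"
    by (auto simp: Form_Cgr_fi_def)
  have "\<FF> A \<subseteq> \<GG> A \<longleftrightarrow> languages_of U S Sg \<FF> A \<subseteq> languages_of U S Sg \<GG> A"
    if A: "A \<in> sorted_sets U S" for A
  proof
    show "languages_of U S Sg \<FF> A \<subseteq> languages_of U S Sg \<GG> A" if "\<FF> A \<subseteq> \<GG> A"
      using A that by (auto simp: languages_of_def languages_def)
  next
    assume "languages_of U S Sg \<FF> A \<subseteq> languages_of U S Sg \<GG> A"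
    \<comment> \<open>The order is reflected because the inverse map is monotone too: a larger
      family of languages admits more congruences.\<close>
    then have "congruences_of U S Sg (languages_of U S Sg \<FF>) A
        \<subseteq> congruences_of U S Sg (languages_of U S Sg \<GG>) A"
      using A by (auto simp: congruences_of_def congruences_def)
    then show "\<FF> A \<subseteq> \<GG> A"
      by (simp add: congruences_of_languages_of F G)
  qed
  then show "\<FF> \<sqsubseteq>\<^bsub>Form_Cgr_fi U S Sg\<^esub> \<GG> \<longleftrightarrow>
      languages_of U S Sg \<FF> \<sqsubseteq>\<^bsub>Form_Lang_r U S Sg\<^esub> languages_of U S Sg \<GG>"
    by (simp add: Form_Cgr_fi_def Form_Lang_r_def)
qed

end

section \<open>Completeness of the two lattices\<close>

definition all_fi where
  "all_fi U S Sg = (\<lambda>A\<in>sorted_sets U S.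
     {\<Phi> \<in> Cgr S Sg (free_alg S Sg A). finite_index S (free_alg S Sg A) \<Phi>})"

text \<open>A top and infima of nonempty families suffice for completeness. Nonempty families have
  pointwise intersections as infima; the empty family is left to the top, since its pointwise
  intersection would be the whole type.\<close>

lemma complete_lattice_pointwise:
  fixes D :: "'d set" and K :: "('d \<Rightarrow> 'v set) set"
  assumes ext: "K \<subseteq> extensional D"
    and top: "T \<in> K" "\<And>F A. F \<in> K \<Longrightarrow> A \<in> D \<Longrightarrow> F A \<subseteq> T A"
    and inter: "\<And>M. M \<subseteq> K \<Longrightarrow> M \<noteq> {} \<Longrightarrow> (\<lambda>A\<in>D. \<Inter>F\<in>M. F A) \<in> K"
  shows "complete_lattice \<lparr>carrier = K, eq = (=), le = (\<lambda>F G. \<forall>A\<in>D. F A \<subseteq> G A)\<rparr>"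
    (is "complete_lattice ?L")
proof -
  interpret partial_order ?L
  proof unfold_locales
    fix F G assume "F \<in> carrier ?L" "G \<in> carrier ?L" and le: "F \<sqsubseteq>\<^bsub>?L\<^esub> G" "G \<sqsubseteq>\<^bsub>?L\<^esub> F"
    then have "F \<in> extensional D" "G \<in> extensional D" using ext by auto
    then have "F = G" by (rule extensionalityI) (use le in auto)
    then show "F .=\<^bsub>?L\<^esub> G" by simp
  qed auto
  show ?thesis
  proof (rule complete_lattice_criterion1)
    show "\<exists>g. greatest ?L g (carrier ?L)"
      using top by (auto simp: greatest_def)
    fix M assume "M \<subseteq> carrier ?L" "M \<noteq> {}"
    then show "\<exists>i. greatest ?L i (Lower ?L M)"
      using inter[of M]
      by (intro exI[of _ "\<lambda>A\<in>D. \<Inter>F\<in>M. F A"]) (auto simp: greatest_def Lower_def)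
  qed
qed

context
  fixes U :: "'x set set" and S :: "'s set" and Sg :: "'s list \<Rightarrow> 's \<Rightarrow> 'f set"
  assumes S: "finite S"
begin

interpretation T: finite_sorted_algebra S Sg "free_alg S Sg A" for A :: "'s \<Rightarrow> 'x set"
  using S by (rule finite_sorted_algebra_free_alg)

text \<open>Finite index passes to coarser congruences, to intersections and to kernels of
  homomorphisms into a quotient of finite index. This formation is the top of one lattice, and its
  image under \<open>languages_of\<close> is the top of the other.\<close>

lemma all_fi_formation: "formation_cgr_fi U S Sg (all_fi U S Sg)"
  unfolding formation_cgr_fi_iff
proof (intro conjI ballI impI)
  show "all_fi U S Sg \<in> extensional (sorted_sets U S)"
    by (simp add: all_fi_def)
next
  fix A assume A: "A \<in> sorted_sets U S"
  let ?A = "free_alg S Sg A"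
  have "nabla S Sg ?A \<in> all_fi U S Sg A"
    using A T.nabla_congruence T.nabla_finite_index by (simp add: all_fi_def Cgr_def)
  then show "fi_filter S Sg ?A (all_fi U S Sg A)"
    using A finite_index_mono[OF S] congruence_Int finite_index_Int[OF S]
    unfolding fi_filter_def cgr_filter_def all_fi_def Cgr_def by auto
next
  fix A B :: "'s \<Rightarrow> 'x set" and \<Theta> f
  assume A: "A \<in> sorted_sets U S" and B: "B \<in> sorted_sets U S" "\<Theta> \<in> all_fi U S Sg B"
    and f: "f \<in> homs S Sg (free_alg S Sg A) (free_alg S Sg B)"
  then have c: "congruence S Sg (free_alg S Sg B) \<Theta>" and fi: "finite_index S (free_alg S Sg B) \<Theta>"
    by (auto simp: all_fi_def Cgr_def)
  note hom = pr_comp_homs[OF c f]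
  show "Ker S (free_alg S Sg A) (\<lambda>s. pr \<Theta> s \<circ> f s) \<in> all_fi U S Sg A"
    using A T.Ker_congruence[OF hom] Ker_finite_index[OF S fi hom] by (simp add: all_fi_def Cgr_def)
qed

lemma complete_lattice_Form_Cgr_fi: "complete_lattice (Form_Cgr_fi U S Sg)"
  unfolding Form_Cgr_fi_def
proof (rule complete_lattice_pointwise)
  show "all_fi U S Sg \<in> {\<FF>. formation_cgr_fi U S Sg \<FF>}"
    using all_fi_formation by simp
  show "\<FF> A \<subseteq> all_fi U S Sg A" if "\<FF> \<in> {\<FF>. formation_cgr_fi U S Sg \<FF>}" "A \<in> sorted_sets U S" for \<FF> A
    using that by (auto simp: all_fi_def formation_cgr_fi_def cgr_filter_def)
next
  fix M assume M: "M \<subseteq> {\<FF>. formation_cgr_fi U S Sg \<FF>}" "M \<noteq> {}"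
  let ?I = "\<lambda>A\<in>sorted_sets U S. \<Inter>\<FF>\<in>M. \<FF> A"
  have fil: "fi_filter S Sg (free_alg S Sg A) (\<FF> A)" if "\<FF> \<in> M" "A \<in> sorted_sets U S" for \<FF> A
    using M that by (auto simp: formation_cgr_fi_iff)
  have "fi_filter S Sg (free_alg S Sg A) (?I A)" if A: "A \<in> sorted_sets U S" for A
  proof -
    obtain \<FF> where F: "\<FF> \<in> M" using M by blast
    have sub: "?I A \<subseteq> \<FF> A" using A F by auto
    \<comment> \<open>The greatest congruence lies in every filter, so the intersection of the
      filters is nonempty.\<close>
    have "nabla S Sg (free_alg S Sg A) \<in> ?I A"
      using A T.fi_filter_nabla[OF fil] by simp
    moreover have "?I A \<subseteq> Cgr S Sg (free_alg S Sg A)"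
      using sub T.fi_filter_congruence[OF fil[OF F A]] unfolding Cgr_def by blast
    moreover have "\<forall>\<Phi>\<in>?I A. finite_index S (free_alg S Sg A) \<Phi>"
      using sub T.fi_filter_finite_index[OF fil[OF F A]] by blast
    moreover have "\<forall>\<Phi>\<in>?I A. \<forall>\<Psi>\<in>?I A. (\<lambda>s. \<Phi> s \<inter> \<Psi> s) \<in> ?I A"
      using A T.fi_filter_Int[OF fil] by simp
    moreover have "\<forall>\<Phi>\<in>?I A. \<forall>\<Psi>\<in>Cgr S Sg (free_alg S Sg A). \<Phi> \<le> \<Psi> \<longrightarrow> \<Psi> \<in> ?I A"
      using A T.fi_filter_upward[OF fil] by (auto simp: Cgr_def)
    ultimately show ?thesis
      unfolding fi_filter_def cgr_filter_def by (intro conjI) (assumption | blast)+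
  qed
  moreover have "Ker S (free_alg S Sg A) (\<lambda>s. pr \<Theta> s \<circ> f s) \<in> ?I A"
    if "A \<in> sorted_sets U S" "B \<in> sorted_sets U S" "\<Theta> \<in> ?I B"
      "f \<in> homs S Sg (free_alg S Sg A) (free_alg S Sg B)"
      "epi S Sg (free_alg S Sg A) (quotient_alg (free_alg S Sg B) \<Theta>) (\<lambda>s. pr \<Theta> s \<circ> f s)" for A B \<Theta> f
    using that M by (auto simp: formation_cgr_fi_iff subset_iff)
  ultimately show "?I \<in> {\<FF>. formation_cgr_fi U S Sg \<FF>}"
    unfolding formation_cgr_fi_iff by blast
qed (auto simp: formation_cgr_fi_iff)

text \<open>Every formation of languages is \<open>languages_of\<close> of some formation of
  congruences, which lies below \<open>all_fi\<close>; monotonicity then makes the image of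
  \<open>all_fi\<close> the top. Infima are again pointwise intersections.\<close>

lemma complete_lattice_Form_Lang_r: "complete_lattice (Form_Lang_r U S Sg)"
  unfolding Form_Lang_r_def
proof (rule complete_lattice_pointwise)
  show "languages_of U S Sg (all_fi U S Sg) \<in> {\<L>. formation_lang_r U S Sg \<L>}"
    using languages_of_formation[OF S all_fi_formation] by simp
  show "\<L> A \<subseteq> languages_of U S Sg (all_fi U S Sg) A"
    if "\<L> \<in> {\<L>. formation_lang_r U S Sg \<L>}" "A \<in> sorted_sets U S" for \<L> A
  proof -
    have "\<L> A = languages_of U S Sg (congruences_of U S Sg \<L>) A"
      using that by (simp add: languages_of_congruences_of[OF S])
    also have "\<dots> \<subseteq> languages_of U S Sg (all_fi U S Sg) A"
      using that(2) by (auto simp: languages_of_def languages_def congruences_of_def congruences_def all_fi_def)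
    finally show ?thesis .
  qed
next
  fix M assume M: "M \<subseteq> {\<L>. formation_lang_r U S Sg \<L>}" "M \<noteq> {}"
  let ?I = "\<lambda>A\<in>sorted_sets U S. \<Inter>\<L>\<in>M. \<L> A"
  have fam: "language_family S Sg (free_alg S Sg A) (\<L> A)" if "\<L> \<in> M" "A \<in> sorted_sets U S" for \<L> A
    using M that by (auto simp: formation_lang_r_iff)
  have "language_family S Sg (free_alg S Sg A) (?I A)" if A: "A \<in> sorted_sets U S" for A
  proof -
    have I: "?I A = (\<Inter>\<L>\<in>M. \<L> A)" using A by simp
    obtain \<L> where "\<L> \<in> M" using M by blast
    then have "(\<Inter>\<L>\<in>M. \<L> A) \<subseteq> \<L> A" and "\<L> A \<subseteq> Lang_r S Sg (free_alg S Sg A)"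
      using fam[OF _ A] by (auto simp: language_family_def)
    then have regular: "(\<Inter>\<L>\<in>M. \<L> A) \<subseteq> Lang_r S Sg (free_alg S Sg A)" by (rule subset_trans)
    have nabla: "Sat S (free_alg S Sg A) (nabla S Sg (free_alg S Sg A)) \<subseteq> (\<Inter>\<L>\<in>M. \<L> A)"
      using fam[OF _ A] by (intro INT_greatest) (simp add: language_family_def)
    have inter: "Sat S (free_alg S Sg A) (\<lambda>s. Omega S Sg (free_alg S Sg A) L s \<inter>
        Omega S Sg (free_alg S Sg A) L' s) \<subseteq> (\<Inter>\<L>\<in>M. \<L> A)"
      if "L \<in> (\<Inter>\<L>\<in>M. \<L> A)" "L' \<in> (\<Inter>\<L>\<in>M. \<L> A)" for L L'
      using fam[OF _ A] that by (intro INT_greatest) (simp add: language_family_def)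
    show ?thesis unfolding I language_family_def
      by (intro conjI ballI regular nabla inter)
  qed
  moreover have "Sat S (free_alg S Sg A) (Ker S (free_alg S Sg A)
      (\<lambda>s. pr (Omega S Sg (free_alg S Sg B) L) s \<circ> f s)) \<subseteq> ?I A"
    if "A \<in> sorted_sets U S" "B \<in> sorted_sets U S" "L \<in> ?I B"
      "f \<in> homs S Sg (free_alg S Sg A) (free_alg S Sg B)"
      "epi S Sg (free_alg S Sg A) (quotient_alg (free_alg S Sg B) (Omega S Sg (free_alg S Sg B) L))
        (\<lambda>s. pr (Omega S Sg (free_alg S Sg B) L) s \<circ> f s)" for A B L f
  proof -
    have "Sat S (free_alg S Sg A) (Ker S (free_alg S Sg A)
      (\<lambda>s. pr (Omega S Sg (free_alg S Sg B) L) s \<circ> f s)) \<subseteq> \<L> A" if "\<L> \<in> M" for \<L>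
    proof -
      have "formation_lang_r U S Sg \<L>" "L \<in> \<L> B" using that M \<open>L \<in> ?I B\<close> \<open>B \<in> _\<close> by auto
      then show ?thesis
        using \<open>A \<in> _\<close> \<open>B \<in> _\<close> \<open>f \<in> _\<close> \<open>epi _ _ _ _ _\<close> unfolding formation_lang_r_iff Let_def by blast
    qed
    then show ?thesis using \<open>A \<in> _\<close> by auto
  qed
  ultimately show "?I \<in> {\<L>. formation_lang_r U S Sg \<L>}"
    unfolding formation_lang_r_iff Let_def by auto
qed (auto simp: formation_lang_r_iff)

end

section \<open>Supports of free algebras and finiteness of \<open>S\<close>\<close>

lemma supp_subset_supp_free_alg: "supp S A \<subseteq> supp S (car (free_alg S Sg A))"
proof
  fix s assume "s \<in> supp S A"
  then obtain x where "s \<in> S" "x \<in> A s" by (auto simp: supp_def)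
  then have "Var s x \<in> car (free_alg S Sg A) s" by (simp add: free_alg_def well_sorted.Var)
  with \<open>s \<in> S\<close> show "s \<in> supp S (car (free_alg S Sg A))" by (auto simp: supp_def)
qed

theorem proposition6p23:
  fixes el :: "'u \<Rightarrow> 'u set"
    and S :: "'u set"
    and Sg :: "'u list \<Rightarrow> 'u \<Rightarrow> 'u set"
  assumes "grothendieck_universe el"
    and "S \<in> range el"
    and "\<And>w s. w \<in> lists S \<Longrightarrow> s \<in> S \<Longrightarrow> Sg w s \<in> range el"
  shows "((\<forall>A\<in>sorted_sets (range el) S. finite (supp S (car (free_alg S Sg A)))) \<longleftrightarrow> finite S) \<and>
         ((\<forall>A\<in>sorted_sets (range el) S. finite (supp S (car (free_alg S Sg A)))) \<longrightarrow>
            complete_lattice (Form_Cgr_fi (range el) S Sg) \<and>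
            complete_lattice (Form_Lang_r (range el) S Sg) \<and>
            lattice_isomorphic (Form_Cgr_fi (range el) S Sg) (Form_Lang_r (range el) S Sg))"
proof -
  have iff: "(\<forall>A\<in>sorted_sets (range el) S. finite (supp S (car (free_alg S Sg A)))) \<longleftrightarrow> finite S"
  proof
    \<comment> \<open>Any element of the type will do: its singleton is in the universe by pairing,
      as \<open>{x, x}\<close>, so every sort can be given a one-point set, and the support is then
      all of \<open>S\<close>.\<close>
    fix x :: 'u
    let ?A = "\<lambda>s. if s \<in> S then {x} else {}"
    assume "\<forall>A\<in>sorted_sets (range el) S. finite (supp S (car (free_alg S Sg A)))"
    moreover have "\<forall>x y. {x, y} \<in> range el"
      using assms(1) unfolding grothendieck_universe_def by (elim conjE)
    then have "{x, x} \<in> range el" by (elim allE)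
    then have "?A \<in> sorted_sets (range el) S" by (simp add: sorted_sets_def)
    ultimately have "finite (supp S (car (free_alg S Sg ?A)))" by blast
    then have "finite (supp S ?A)"
      using supp_subset_supp_free_alg by (rule finite_subset[rotated])
    moreover have "supp S ?A = S" by (auto simp: supp_def)
    ultimately show "finite S" by simp
  next
    assume "finite S"
    then show "\<forall>A\<in>sorted_sets (range el) S. finite (supp S (car (free_alg S Sg A)))"
      by (simp add: supp_def)
  qed
  show ?thesis
    unfolding iff
    by (intro conjI impI refl complete_lattice_Form_Cgr_fi complete_lattice_Form_Lang_r
        lattice_isomorphic_formations)
qed

end
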